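(* Let $\mathbb{F}_2=\langle a,b\rangle$ be the free group on two generators $a,b$, and let $u\in L(\langle b\rangle)$ be a unitary. Then $$\mathrm{d}_{\mathrm{MT}}\big(L(\langle a\rangle),\,uL(\langle a\rangle)u^*\big)=\sqrt{1-|\tau(u)|^4}.$$
   Context: For a countable discrete group $G$, $L(G)=\{\lambda_g:g\in G\}''\subseteq B(\ell^2(G))$ is the group von Neumann algebra, with canonical trace $\tau(x)=\langle x\delta_e,\delta_e\rangle$; for a subgroup $H\le G$, $L(H)$ is viewed as the subalgebra $\{\lambda_h:h\in H\}''$ of $L(G)$. Mashood–Taylor distance: for von Neumann subalgebras $P,Q$ of $(M,\tau)$, $\mathrm{d}_{\mathrm{MT}}(P,Q)=\max\{\sup_{x\in (P)_1}\inf_{y\in (Q)_1}\|x-y\|_\tau,\ \sup_{y\in (Q)_1}\inf_{x\in (P)_1}\|x-y\|_\tau\}$, where $(X)_1$ is the operator-norm closed unit ball and $\|x\|_\tau=\tau(x^*x)^{1/2}$. Here $M=L(\mathbb{F}_2)$. *)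

theory Defs
  imports "HOL-Analysis.Infinite_Sum" "HOL-Algebra.Generated_Groups"
begin

section \<open>The Hilbert space of square-summable functions\<close>

text \<open>
  Vectors of the Hilbert space over an index set \<open>S\<close> are functions on the whole type that vanish
  outside \<open>S\<close>, so that equality of vectors is equality of functions.  The inner product is linear
  in the first argument.
\<close>

definition ell2 :: "'i set \<Rightarrow> ('i \<Rightarrow> complex) set" where
  "ell2 S = {f. (\<lambda>i. (cmod (f i))\<^sup>2) summable_on S \<and> (\<forall>i. i \<notin> S \<longrightarrow> f i = 0)}"

definition ell2_inner :: "'i set \<Rightarrow> ('i \<Rightarrow> complex) \<Rightarrow> ('i \<Rightarrow> complex) \<Rightarrow> complex" where
  "ell2_inner S f g = (\<Sum>\<^sub>\<infinity>i\<in>S. f i * cnj (g i))"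

definition ell2_norm :: "'i set \<Rightarrow> ('i \<Rightarrow> complex) \<Rightarrow> real" where
  "ell2_norm S f = sqrt (\<Sum>\<^sub>\<infinity>i\<in>S. (cmod (f i))\<^sup>2)"

definition ell2_delta :: "'i \<Rightarrow> 'i \<Rightarrow> complex" where
  "ell2_delta j = (\<lambda>i. if i = j then 1 else 0)"


section \<open>Bounded operators\<close>

type_synonym 'i ell2_op = "('i \<Rightarrow> complex) \<Rightarrow> ('i \<Rightarrow> complex)"

text \<open>
  Operators send everything outside the Hilbert space to zero, so that equality of operators is
  equality of functions.  Since operators map zero to zero, this convention is preserved
  by ordinary composition.
\<close>

definition bounded_ops :: "'i set \<Rightarrow> 'i ell2_op set" where
  "bounded_ops S = {T.
     (\<forall>f\<in>ell2 S. T f \<in> ell2 S) \<and>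
     (\<forall>f\<in>ell2 S. \<forall>g\<in>ell2 S. T (\<lambda>i. f i + g i) = (\<lambda>i. T f i + T g i)) \<and>
     (\<forall>c. \<forall>f\<in>ell2 S. T (\<lambda>i. c * f i) = (\<lambda>i. c * T f i)) \<and>
     (\<exists>K. \<forall>f\<in>ell2 S. ell2_norm S (T f) \<le> K * ell2_norm S f) \<and>
     (\<forall>f. f \<notin> ell2 S \<longrightarrow> T f = (\<lambda>_. 0))}"

definition op_id :: "'i set \<Rightarrow> 'i ell2_op" where
  "op_id S = (\<lambda>f. if f \<in> ell2 S then f else (\<lambda>_. 0))"

definition op_diff :: "'i ell2_op \<Rightarrow> 'i ell2_op \<Rightarrow> 'i ell2_op" where
  "op_diff T U = (\<lambda>f i. T f i - U f i)"

definition op_norm :: "'i set \<Rightarrow> 'i ell2_op \<Rightarrow> real" where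
  "op_norm S T = (SUP f \<in> {f \<in> ell2 S. ell2_norm S f \<le> 1}. ell2_norm S (T f))"

definition op_adjoint :: "'i set \<Rightarrow> 'i ell2_op \<Rightarrow> 'i ell2_op" where
  "op_adjoint S T = (THE T'. T' \<in> bounded_ops S \<and>
     (\<forall>f\<in>ell2 S. \<forall>g\<in>ell2 S. ell2_inner S (T f) g = ell2_inner S f (T' g)))"

definition unitary_op :: "'i set \<Rightarrow> 'i ell2_op \<Rightarrow> bool" where
  "unitary_op S U \<longleftrightarrow> U \<in> bounded_ops S \<and>
     op_adjoint S U \<circ> U = op_id S \<and> U \<circ> op_adjoint S U = op_id S"

definition commutant :: "'i set \<Rightarrow> 'i ell2_op set \<Rightarrow> 'i ell2_op set" where
  "commutant S X = {T \<in> bounded_ops S. \<forall>U\<in>X. T \<circ> U = U \<circ> T}"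

definition op_conjugate :: "'i set \<Rightarrow> 'i ell2_op \<Rightarrow> 'i ell2_op set \<Rightarrow> 'i ell2_op set" where
  "op_conjugate S U X = (\<lambda>T. U \<circ> T \<circ> op_adjoint S U) ` X"


section \<open>Mashood--Taylor distance\<close>

definition op_unit_ball :: "'i set \<Rightarrow> 'i ell2_op set \<Rightarrow> 'i ell2_op set" where
  "op_unit_ball S X = {T \<in> X. op_norm S T \<le> 1}"

text \<open>
  The parameter \<open>\<tau>\<close> is a positive trace on an algebra containing the operator \<open>T\<close>, so the real
  part below is taken of a nonnegative real number.
\<close>

definition trace_norm :: "'i set \<Rightarrow> ('i ell2_op \<Rightarrow> complex) \<Rightarrow> 'i ell2_op \<Rightarrow> real" where
  "trace_norm S \<tau> T = sqrt (Re (\<tau> (op_adjoint S T \<circ> T)))"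

definition mt_dist ::
    "'i set \<Rightarrow> ('i ell2_op \<Rightarrow> complex) \<Rightarrow> 'i ell2_op set \<Rightarrow> 'i ell2_op set \<Rightarrow> real" where
  "mt_dist S \<tau> P Q = max
     (SUP x \<in> op_unit_ball S P. INF y \<in> op_unit_ball S Q. trace_norm S \<tau> (op_diff x y))
     (SUP y \<in> op_unit_ball S Q. INF x \<in> op_unit_ball S P. trace_norm S \<tau> (op_diff x y))"


section \<open>Group von Neumann algebras\<close>

definition left_translation :: "('g, 'm) monoid_scheme \<Rightarrow> 'g \<Rightarrow> 'g ell2_op" where
  "left_translation G g = (\<lambda>f. if f \<in> ell2 (carrier G)
     then (\<lambda>x. if x \<in> carrier G then f (inv\<^bsub>G\<^esub> g \<otimes>\<^bsub>G\<^esub> x) else 0)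
     else (\<lambda>_. 0))"

text \<open>
  For a subgroup \<open>H\<close> of \<open>G\<close>, this is \<open>L(H)\<close> regarded as a subalgebra of \<open>L(G)\<close>, acting on the
  Hilbert space of \<open>G\<close>; \<open>L(G)\<close> itself is the case \<open>H = carrier G\<close>.
\<close>

definition group_vN :: "('g, 'm) monoid_scheme \<Rightarrow> 'g set \<Rightarrow> 'g ell2_op set" where
  "group_vN G H =
     commutant (carrier G) (commutant (carrier G) (left_translation G ` H))"

definition canonical_trace :: "('g, 'm) monoid_scheme \<Rightarrow> 'g ell2_op \<Rightarrow> complex" where
  "canonical_trace G T = ell2_inner (carrier G) (T (ell2_delta \<one>\<^bsub>G\<^esub>)) (ell2_delta \<one>\<^bsub>G\<^esub>)"


section \<open>Free groups\<close>

text \<open>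
  A letter \<open>(x, True)\<close> stands for the generator \<open>x\<close> and \<open>(x, False)\<close> for its inverse.  Elements
  of the free group are reduced words; the product is the reduced form of the concatenation.
\<close>

type_synonym 'x letter = "'x \<times> bool"

definition inv_letter :: "'x letter \<Rightarrow> 'x letter" where
  "inv_letter l = (fst l, \<not> snd l)"

definition reduced_word :: "'x letter list \<Rightarrow> bool" where
  "reduced_word = successively (\<lambda>k l. l \<noteq> inv_letter k)"

fun cons_letter :: "'x letter \<Rightarrow> 'x letter list \<Rightarrow> 'x letter list" where
  "cons_letter k [] = [k]"
| "cons_letter k (l # w) = (if l = inv_letter k then w else k # l # w)"

definition free_group :: "'x set \<Rightarrow> 'x letter list monoid" where
  "free_group X = \<lparr>
     carrier = {w. reduced_word w \<and> fst ` set w \<subseteq> X},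
     mult = (\<lambda>v w. foldr cons_letter v w),
     one = []\<rparr>"

definition free_gen :: "'x \<Rightarrow> 'x letter list" where
  "free_gen x = [(x, True)]"

lemma inv_letter_inv_letter [simp]: "inv_letter (inv_letter l) = l"
  by (simp add: inv_letter_def)

lemma fst_inv_letter [simp]: "fst (inv_letter l) = fst l"
  by (simp add: inv_letter_def)

lemma inv_letter_neq [simp]: "inv_letter l \<noteq> l" "l \<noteq> inv_letter l"
  by (cases l; simp add: inv_letter_def)+

lemma reduced_word_Nil [simp]: "reduced_word []"
  by (simp add: reduced_word_def)

lemma reduced_word_ConsD: "reduced_word (l # w) \<Longrightarrow> reduced_word w"
  by (cases w) (auto simp: reduced_word_def)

lemma reduced_cons_letter: "reduced_word w \<Longrightarrow> reduced_word (cons_letter l w)"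
  by (cases w) (auto simp: reduced_word_def dest: reduced_word_ConsD[unfolded reduced_word_def])

lemma set_cons_letter: "set (cons_letter l w) \<subseteq> insert l (set w)"
  by (cases w) auto

lemma cons_letter_cancel:
  assumes "reduced_word w"
  shows "cons_letter l (cons_letter (inv_letter l) w) = w"
proof (cases w)
  case Nil
  then show ?thesis by simp
next
  case (Cons k v)
  then show ?thesis
    using assms by (cases v) (auto simp: reduced_word_def)
qed

lemma cons_letter_reduced: "reduced_word (l # w) \<Longrightarrow> cons_letter l w = l # w"
  by (cases w) (auto simp: reduced_word_def)

lemma reduced_foldr_cons_letter:
  "reduced_word w \<Longrightarrow> reduced_word (foldr cons_letter v w)"
  by (induction v) (auto intro: reduced_cons_letter)

lemma set_foldr_cons_letter: "set (foldr cons_letter v w) \<subseteq> set v \<union> set w"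
  by (induction v) (use set_cons_letter in fastforce)+

lemma foldr_cons_letter_Nil: "reduced_word w \<Longrightarrow> foldr cons_letter w [] = w"
proof (induction w)
  case (Cons l w)
  then show ?case
    using reduced_word_ConsD[of l w] cons_letter_reduced[of l w] by simp
qed simp

lemma foldr_cons_letter_cons:
  assumes "reduced_word w"
  shows "foldr cons_letter (cons_letter l v) w = cons_letter l (foldr cons_letter v w)"
proof (cases v)
  case (Cons k v')
  then show ?thesis
    using cons_letter_cancel[OF reduced_foldr_cons_letter[OF assms], of l v'] by auto
qed simp

lemma foldr_cons_letter_assoc:
  assumes "reduced_word w"
  shows "foldr cons_letter (foldr cons_letter u v) w =
    foldr cons_letter u (foldr cons_letter v w)"
  by (induction u) (auto simp: foldr_cons_letter_cons[OF assms])

lemma foldr_cons_letter_inverse: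
  assumes "reduced_word w"
  shows "foldr cons_letter (map inv_letter (rev v)) (foldr cons_letter v w) = w"
  using assms
proof (induction v arbitrary: w)
  case (Cons l v)
  have "cons_letter (inv_letter l) (cons_letter l z) = z" if "reduced_word z" for z
    using cons_letter_cancel[OF that, of "inv_letter l"] by simp
  then show ?case
    using Cons by (simp add: reduced_foldr_cons_letter)
qed simp

lemma reduced_word_inverse:
  assumes "reduced_word w"
  shows "reduced_word (map inv_letter (rev w))"
proof -
  have "successively (\<lambda>k l. k \<noteq> inv_letter l) w"
    using assms unfolding reduced_word_def
    by (rule successively_mono) (auto simp: inv_letter_def)
  then show ?thesis
    unfolding reduced_word_def successively_map successively_rev
    by (rule successively_mono) (metis inv_letter_inv_letter)
qed

theorem group_free_group: "group (free_group X)"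
proof (rule groupI)
  fix v w assume "v \<in> carrier (free_group X)" "w \<in> carrier (free_group X)"
  then show "v \<otimes>\<^bsub>free_group X\<^esub> w \<in> carrier (free_group X)"
    using set_foldr_cons_letter[of v w]
    by (fastforce simp: free_group_def intro: reduced_foldr_cons_letter)
next
  fix w assume w: "w \<in> carrier (free_group X)"
  then have "map inv_letter (rev w) \<in> carrier (free_group X)"
    by (auto simp: free_group_def intro: reduced_word_inverse)
  moreover have "map inv_letter (rev w) \<otimes>\<^bsub>free_group X\<^esub> w = \<one>\<^bsub>free_group X\<^esub>"
    using w foldr_cons_letter_inverse[of "[]" w]
    by (simp add: free_group_def foldr_cons_letter_Nil)
  ultimately show "\<exists>v \<in> carrier (free_group X). v \<otimes>\<^bsub>free_group X\<^esub> w = \<one>\<^bsub>free_group X\<^esub>"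
    by blast
qed (auto simp: free_group_def foldr_cons_letter_assoc)

datatype generator = Gen_a | Gen_b

abbreviation F2 :: "generator letter list monoid" where
  "F2 \<equiv> free_group UNIV"

abbreviation gen_a :: "generator letter list" where
  "gen_a \<equiv> free_gen Gen_a"

abbreviation gen_b :: "generator letter list" where
  "gen_b \<equiv> free_gen Gen_b"

end

theory Submission
  imports Defs
begin

text \<open>
  Write \<open>e\<close> for the unit of the group, \<open>A\<close> and \<open>B\<close> for the subgroups generated by \<open>a\<close> and \<open>b\<close>, and
  \<open>c = |\<tau>(u)|\<^sup>2\<close>.  An operator \<open>T\<close> in the group algebra is studied through the vector \<open>T\<delta>\<^sub>e\<close>, whose
  norm is the trace norm of \<open>T\<close>.  If \<open>T\<close> belongs to \<open>L(H)\<close>, then it commutes with right translations, so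
  it acts as convolution by \<open>T\<delta>\<^sub>e\<close>, and it commutes with the projection onto \<open>\<ell>\<^sup>2(H)\<close>, so \<open>T\<delta>\<^sub>e\<close> is
  supported in \<open>H\<close> (\<open>right_commutant_convolution\<close>, \<open>group_vN_support\<close>).

  Let \<open>x\<close> and \<open>z\<close> be in \<open>L(A)\<close>.  The square of the distance from \<open>x\<close> to \<open>u z u\<^sup>*\<close> is
  \<open>\<parallel>x\<parallel>\<^sup>2 + \<parallel>z\<parallel>\<^sup>2 - 2 Re \<langle>u\<^sup>* x \<delta>\<^sub>e, z u\<^sup>* \<delta>\<^sub>e\<rangle>\<close>.  The first vector in the inner product lives on words
  \<open>b\<^sup>k a\<^sup>n\<close>, the second on words \<open>a\<^sup>m b\<^sup>l\<close>, and the only words of both kinds are the powers of \<open>a\<close> and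
  the powers of \<open>b\<close>.  The inner product is therefore
  \<open>c \<langle>x \<delta>\<^sub>e, z \<delta>\<^sub>e\<rangle>\<close> plus \<open>1 - c\<close> times the product of \<open>\<tau>(x)\<close> with the conjugate of \<open>\<tau>(z)\<close>
  (\<open>inner_swapped_products\<close>, \<open>distance_to_conjugate\<close>).

  The resulting formula is symmetric in \<open>x\<close> and \<open>z\<close>, so the two suprema in the Mashood--Taylor distance
  coincide.  For fixed \<open>x\<close> the optimal choice is \<open>z = c x + (1 - c) \<tau>(x) 1\<close>; it lies in the unit ball
  because it is a convex combination of \<open>x\<close> and a scalar of modulus at most one, and the square distance is
  \<open>(1 - c\<^sup>2) (\<parallel>x\<parallel>\<^sup>2 - |\<tau>(x)|\<^sup>2) \<le> 1 - c\<^sup>2\<close> (\<open>conjugate_near\<close>).  The translation by \<open>a\<close> attains this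
  bound (\<open>conjugate_far\<close>).  Freeness enters only through the statement about words, so the distance
  is computed for any pair of subgroups satisfying it (\<open>free_pair\<close>).
\<close>

section \<open>Inner product and norm\<close>

lemma ell2_memI:
  assumes "(\<lambda>i. (cmod (f i))\<^sup>2) summable_on S" and "\<And>i. i \<notin> S \<Longrightarrow> f i = 0"
  shows "f \<in> ell2 S"
  using assms by (simp add: ell2_def)

lemma ell2_summable: "f \<in> ell2 S \<Longrightarrow> (\<lambda>i. (cmod (f i))\<^sup>2) summable_on S"
  by (simp add: ell2_def)

lemma ell2_outside: "f \<in> ell2 S \<Longrightarrow> i \<notin> S \<Longrightarrow> f i = 0"
  by (simp add: ell2_def)

lemma ell2_comparison:
  assumes "g \<in> ell2 S" and "\<And>i. i \<in> S \<Longrightarrow> cmod (f i) \<le> cmod (g i)" and "\<And>i. i \<notin> S \<Longrightarrow> f i = 0"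
  shows "f \<in> ell2 S"
proof (rule ell2_memI)
  show "(\<lambda>i. (cmod (f i))\<^sup>2) summable_on S"
    by (rule summable_on_comparison_test[OF ell2_summable[OF assms(1)]])
      (use assms(2) in \<open>auto intro: power_mono\<close>)
qed (rule assms(3))

lemma ell2_finite_support:
  assumes "finite F" "F \<subseteq> S" "\<And>i. i \<notin> F \<Longrightarrow> f i = 0"
  shows "f \<in> ell2 S"
proof (rule ell2_memI)
  show "(\<lambda>i. (cmod (f i))\<^sup>2) summable_on S"
    by (subst summable_on_cong_neutral[where T = F and g = "\<lambda>i. (cmod (f i))\<^sup>2"])
      (use assms in auto)
qed (use assms in auto)

lemma ell2_delta_mem [simp]: "j \<in> S \<Longrightarrow> ell2_delta j \<in> ell2 S"
  by (rule ell2_finite_support[of "{j}"]) (auto simp: ell2_delta_def)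

lemma ell2_add [simp]:
  assumes "f \<in> ell2 S" "g \<in> ell2 S"
  shows "(\<lambda>i. f i + g i) \<in> ell2 S"
proof (rule ell2_memI)
  have *: "(cmod (x + y))\<^sup>2 \<le> 2 * (cmod x)\<^sup>2 + 2 * (cmod y)\<^sup>2" for x y
  proof -
    have "(cmod (x + y))\<^sup>2 \<le> (cmod x + cmod y)\<^sup>2"
      by (simp add: norm_triangle_ineq power_mono)
    also have "\<dots> \<le> 2 * (cmod x)\<^sup>2 + 2 * (cmod y)\<^sup>2"
      using sum_squares_bound[of "cmod x" "cmod y"] by (simp add: power2_sum)
    finally show ?thesis .
  qed
  show "(\<lambda>i. (cmod (f i + g i))\<^sup>2) summable_on S"
    by (rule summable_on_comparison_test[where f = "\<lambda>i. 2 * (cmod (f i))\<^sup>2 + 2 * (cmod (g i))\<^sup>2"])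
      (use * assms in \<open>auto intro!: summable_on_add summable_on_cmult_right ell2_summable\<close>)
qed (use assms in \<open>auto simp: ell2_outside\<close>)

lemma ell2_scale [simp]:
  assumes "f \<in> ell2 S"
  shows "(\<lambda>i. c * f i) \<in> ell2 S"
  by (rule ell2_memI)
    (use assms in \<open>auto simp: norm_mult power_mult_distrib ell2_outside
      intro!: summable_on_cmult_right ell2_summable\<close>)

lemma ell2_zero [simp]: "(\<lambda>_. 0) \<in> ell2 S"
  by (rule ell2_memI) auto

lemma ell2_diff [simp]:
  assumes "f \<in> ell2 S" "g \<in> ell2 S"
  shows "(\<lambda>i. f i - g i) \<in> ell2 S"
  using ell2_add[OF assms(1) ell2_scale[OF assms(2), of "-1"]] by simp

lemma ell2_inner_summable:
  assumes "f \<in> ell2 S" "g \<in> ell2 S"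
  shows "(\<lambda>i. f i * cnj (g i)) summable_on S"
proof (rule abs_summable_summable, rule summable_on_comparison_test)
  show "(\<lambda>i. (cmod (f i))\<^sup>2 + (cmod (g i))\<^sup>2) summable_on S"
    using assms by (intro summable_on_add ell2_summable)
  show "norm (f i * cnj (g i)) \<le> (cmod (f i))\<^sup>2 + (cmod (g i))\<^sup>2" for i
  proof -
    have "0 \<le> cmod (f i) * cmod (g i)" by simp
    then show ?thesis
      using sum_squares_bound[of "cmod (f i)" "cmod (g i)"]
      unfolding norm_mult complex_mod_cnj mult.assoc by linarith
  qed
qed auto

lemma ell2_inner_add_left:
  assumes "f \<in> ell2 S" "g \<in> ell2 S" "h \<in> ell2 S"
  shows "ell2_inner S (\<lambda>i. f i + g i) h = ell2_inner S f h + ell2_inner S g h"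
  unfolding ell2_inner_def distrib_right
  by (rule infsum_add) (use assms in \<open>auto intro: ell2_inner_summable\<close>)

lemma ell2_inner_scale_left:
  "ell2_inner S (\<lambda>i. c * f i) g = c * ell2_inner S f g"
  by (simp add: ell2_inner_def mult.assoc infsum_cmult_right')

lemma ell2_inner_commute: "ell2_inner S f g = cnj (ell2_inner S g f)"
  by (simp add: ell2_inner_def mult.commute flip: infsum_cnj)

lemma ell2_inner_diff_left:
  assumes "f \<in> ell2 S" "g \<in> ell2 S" "h \<in> ell2 S"
  shows "ell2_inner S (\<lambda>i. f i - g i) h = ell2_inner S f h - ell2_inner S g h"
  using ell2_inner_add_left[OF assms(1) ell2_scale[OF assms(2), of "-1"] assms(3)]
    ell2_inner_scale_left[of S "-1" g h] by simp

lemma ell2_inner_diff_right: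
  assumes "f \<in> ell2 S" "g \<in> ell2 S" "h \<in> ell2 S"
  shows "ell2_inner S h (\<lambda>i. f i - g i) = ell2_inner S h f - ell2_inner S h g"
  using ell2_inner_diff_left[OF assms] by (metis ell2_inner_commute complex_cnj_diff)

lemma ell2_inner_add_right:
  assumes "f \<in> ell2 S" "g \<in> ell2 S" "h \<in> ell2 S"
  shows "ell2_inner S h (\<lambda>i. f i + g i) = ell2_inner S h f + ell2_inner S h g"
  using ell2_inner_add_left[OF assms] by (metis ell2_inner_commute complex_cnj_add)

lemma ell2_inner_scale_right:
  "ell2_inner S f (\<lambda>i. c * g i) = cnj c * ell2_inner S f g"
  by (metis ell2_inner_commute ell2_inner_scale_left complex_cnj_mult)

lemma ell2_inner_delta_right:
  assumes "j \<in> S"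
  shows "ell2_inner S f (ell2_delta j) = f j"
proof -
  have "ell2_inner S f (ell2_delta j) = (\<Sum>\<^sub>\<infinity>i\<in>{j}. f i * cnj (ell2_delta j i))"
    unfolding ell2_inner_def
    by (rule infsum_cong_neutral) (use assms in \<open>auto simp: ell2_delta_def\<close>)
  then show ?thesis by (simp add: ell2_delta_def)
qed

lemma ell2_inner_delta_left: "j \<in> S \<Longrightarrow> ell2_inner S (ell2_delta j) f = cnj (f j)"
  by (metis ell2_inner_commute ell2_inner_delta_right)

lemma ell2_norm_nonneg [simp]: "0 \<le> ell2_norm S f"
  by (simp add: ell2_norm_def infsum_nonneg)

lemma ell2_norm_square: "(ell2_norm S f)\<^sup>2 = (\<Sum>\<^sub>\<infinity>i\<in>S. (cmod (f i))\<^sup>2)"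
  by (simp add: ell2_norm_def infsum_nonneg)

lemma ell2_inner_self: "ell2_inner S f f = of_real ((ell2_norm S f)\<^sup>2)"
proof -
  let ?q = "\<lambda>i. (cmod (f i))\<^sup>2"
  have "(\<Sum>\<^sub>\<infinity>i\<in>S. complex_of_real (?q i)) = of_real (infsum ?q S)"
  proof (cases "?q summable_on S")
    case True
    then show ?thesis
      by (intro infsumI) (simp only: has_sum_of_real_iff has_sum_infsum)
  next
    case False
    then have "\<not> (\<lambda>i. complex_of_real (?q i)) summable_on S"
      using summable_on_Re[of "\<lambda>i. complex_of_real (?q i)" S] by auto
    with False show ?thesis by (simp add: infsum_not_exists)
  qed
  then show ?thesis
    unfolding ell2_inner_def ell2_norm_square complex_norm_square[symmetric] by simp
qed

lemma ell2_norm_eq_Re: "(ell2_norm S f)\<^sup>2 = Re (ell2_inner S f f)"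
  by (simp add: ell2_inner_self)

lemma ell2_norm_eq_0_iff:
  assumes "f \<in> ell2 S"
  shows "ell2_norm S f = 0 \<longleftrightarrow> f = (\<lambda>_. 0)"
proof
  assume "ell2_norm S f = 0"
  then have "(\<Sum>\<^sub>\<infinity>i\<in>S. (cmod (f i))\<^sup>2) \<le> 0"
    by (simp add: ell2_norm_square[symmetric])
  then have "(cmod (f i))\<^sup>2 = 0" if "i \<in> S" for i
    using nonneg_infsum_le_0D[OF _ ell2_summable[OF assms] _ that] by simp
  then show "f = (\<lambda>_. 0)"
    using ell2_outside[OF assms] by fastforce
qed (simp add: ell2_norm_def)

lemma ell2_norm_scale: "ell2_norm S (\<lambda>i. c * f i) = cmod c * ell2_norm S f"
  by (simp add: ell2_norm_def norm_mult power_mult_distrib infsum_cmult_right' real_sqrt_mult)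

lemma ell2_norm_delta [simp]: "j \<in> S \<Longrightarrow> ell2_norm S (ell2_delta j) = 1"
  using ell2_norm_eq_Re[of S "ell2_delta j"] ell2_inner_delta_right[of j S "ell2_delta j"]
  by (simp add: ell2_delta_def power2_eq_1_iff)
    (metis ell2_norm_nonneg neg_0_le_iff_le not_one_le_zero)

lemma ell2_norm_diff_square:
  assumes "f \<in> ell2 S" "g \<in> ell2 S"
  shows "(ell2_norm S (\<lambda>i. f i - g i))\<^sup>2
    = (ell2_norm S f)\<^sup>2 + (ell2_norm S g)\<^sup>2 - 2 * Re (ell2_inner S f g)"
proof -
  have "Re (ell2_inner S g f) = Re (ell2_inner S f g)"
    by (subst ell2_inner_commute) simp
  then show ?thesis
    using assms by (simp add: ell2_norm_eq_Re ell2_inner_diff_left ell2_inner_diff_right)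
qed

text \<open>
  Expand \<open>0 \<le> \<parallel>n f - p g\<parallel>\<^sup>2\<close> for \<open>n = \<parallel>g\<parallel>\<^sup>2\<close> and \<open>p = \<langle>f, g\<rangle>\<close>, and divide by \<open>n\<close>.
\<close>

lemma ell2_cauchy_schwarz:
  assumes f: "f \<in> ell2 S" and g: "g \<in> ell2 S"
  shows "cmod (ell2_inner S f g) \<le> ell2_norm S f * ell2_norm S g"
proof (cases "ell2_norm S g = 0")
  case True
  then show ?thesis
    by (simp add: ell2_norm_eq_0_iff[OF g] ell2_inner_def)
next
  case False
  define n p where "n = (ell2_norm S g)\<^sup>2" and "p = ell2_inner S f g"
  have n: "n > 0" using False by (simp add: n_def)
  have "0 \<le> (ell2_norm S (\<lambda>i. of_real n * f i - p * g i))\<^sup>2" by simp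
  also have "\<dots> = n\<^sup>2 * (ell2_norm S f)\<^sup>2 - n * (cmod p)\<^sup>2"
    unfolding ell2_norm_diff_square[OF ell2_scale[OF f] ell2_scale[OF g]]
      ell2_norm_scale ell2_inner_scale_left ell2_inner_scale_right
    by (simp add: n_def[symmetric] p_def[symmetric] power_mult_distrib)
      (simp add: cmod_def algebra_simps power2_eq_square)
  finally have "n * (cmod p)\<^sup>2 \<le> n * (n * (ell2_norm S f)\<^sup>2)"
    by (simp add: power2_eq_square algebra_simps)
  then have "(cmod p)\<^sup>2 \<le> (ell2_norm S f * ell2_norm S g)\<^sup>2"
    using n by (simp add: n_def power_mult_distrib mult.commute)
  then show ?thesis
    unfolding p_def by (rule power2_le_imp_le) simp
qed

lemma ell2_norm_triangle:
  assumes f: "f \<in> ell2 S" and g: "g \<in> ell2 S"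
  shows "ell2_norm S (\<lambda>i. f i + g i) \<le> ell2_norm S f + ell2_norm S g"
proof -
  have "(ell2_norm S (\<lambda>i. f i + g i))\<^sup>2 = (ell2_norm S f)\<^sup>2 + (ell2_norm S g)\<^sup>2
      + 2 * Re (ell2_inner S f g)"
    using ell2_norm_diff_square[OF f ell2_scale[OF g, of "-1"]]
      ell2_norm_scale[of S "-1" g] ell2_inner_scale_right[of S f "-1" g] by simp
  also have "\<dots> \<le> (ell2_norm S f + ell2_norm S g)\<^sup>2"
    using ell2_cauchy_schwarz[OF f g] complex_Re_le_cmod[of "ell2_inner S f g"]
    by (simp add: power2_sum)
  finally show ?thesis by (rule power2_le_imp_le) simp
qed

section \<open>Bounded operators and adjoints\<close>

lemma bounded_ops_mem: "T \<in> bounded_ops S \<Longrightarrow> f \<in> ell2 S \<Longrightarrow> T f \<in> ell2 S"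
  by (simp add: bounded_ops_def)

lemma bounded_ops_add:
  "T \<in> bounded_ops S \<Longrightarrow> f \<in> ell2 S \<Longrightarrow> g \<in> ell2 S \<Longrightarrow> T (\<lambda>i. f i + g i) = (\<lambda>i. T f i + T g i)"
  by (simp add: bounded_ops_def)

lemma bounded_ops_scale:
  "T \<in> bounded_ops S \<Longrightarrow> f \<in> ell2 S \<Longrightarrow> T (\<lambda>i. c * f i) = (\<lambda>i. c * T f i)"
  by (simp add: bounded_ops_def)

lemma bounded_ops_outside: "T \<in> bounded_ops S \<Longrightarrow> f \<notin> ell2 S \<Longrightarrow> T f = (\<lambda>_. 0)"
  by (simp add: bounded_ops_def)

lemma bounded_ops_diff:
  assumes "T \<in> bounded_ops S" "f \<in> ell2 S" "g \<in> ell2 S"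
  shows "T (\<lambda>i. f i - g i) = (\<lambda>i. T f i - T g i)"
  using bounded_ops_add[OF assms(1,2) ell2_scale[OF assms(3), of "-1"]]
    bounded_ops_scale[OF assms(1,3), of "-1"] by simp

lemma bounded_ops_bound:
  assumes "T \<in> bounded_ops S"
  obtains K where "K \<ge> 0" "\<And>f. f \<in> ell2 S \<Longrightarrow> ell2_norm S (T f) \<le> K * ell2_norm S f"
proof -
  obtain K where K: "\<forall>f\<in>ell2 S. ell2_norm S (T f) \<le> K * ell2_norm S f"
    using assms by (auto simp: bounded_ops_def)
  show ?thesis
  proof (rule that[of "max K 0"])
    fix f assume "f \<in> ell2 S"
    then have "ell2_norm S (T f) \<le> K * ell2_norm S f" using K by blast
    also have "\<dots> \<le> max K 0 * ell2_norm S f"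
      by (rule mult_right_mono) auto
    finally show "ell2_norm S (T f) \<le> max K 0 * ell2_norm S f" .
  qed simp
qed

lemma bounded_opsI:
  assumes "\<And>f. f \<in> ell2 S \<Longrightarrow> T f \<in> ell2 S"
    and "\<And>f g. f \<in> ell2 S \<Longrightarrow> g \<in> ell2 S \<Longrightarrow> T (\<lambda>i. f i + g i) = (\<lambda>i. T f i + T g i)"
    and "\<And>c f. f \<in> ell2 S \<Longrightarrow> T (\<lambda>i. c * f i) = (\<lambda>i. c * T f i)"
    and "\<And>f. f \<in> ell2 S \<Longrightarrow> ell2_norm S (T f) \<le> K * ell2_norm S f"
    and "\<And>f. f \<notin> ell2 S \<Longrightarrow> T f = (\<lambda>_. 0)"
  shows "T \<in> bounded_ops S"
  using assms unfolding bounded_ops_def by blast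

lemma bounded_ops_comp:
  assumes "T \<in> bounded_ops S" "U \<in> bounded_ops S"
  shows "T \<circ> U \<in> bounded_ops S"
proof -
  obtain K where K: "K \<ge> 0" "\<And>f. f \<in> ell2 S \<Longrightarrow> ell2_norm S (T f) \<le> K * ell2_norm S f"
    using bounded_ops_bound[OF assms(1)] by blast
  obtain L where L: "L \<ge> 0" "\<And>f. f \<in> ell2 S \<Longrightarrow> ell2_norm S (U f) \<le> L * ell2_norm S f"
    using bounded_ops_bound[OF assms(2)] by blast
  show ?thesis
  proof (rule bounded_opsI[where K = "K * L"])
    fix f assume f: "f \<in> ell2 S"
    have "ell2_norm S (T (U f)) \<le> K * ell2_norm S (U f)"
      using K(2) bounded_ops_mem[OF assms(2) f] by blast
    also have "\<dots> \<le> K * (L * ell2_norm S f)"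
      using L(2)[OF f] K(1) by (rule mult_left_mono)
    finally show "ell2_norm S ((T \<circ> U) f) \<le> K * L * ell2_norm S f" by (simp add: mult.assoc)
  qed (use bounded_ops_scale[OF assms(1) ell2_zero, of 0] in
      \<open>auto simp: assms bounded_ops_mem[OF assms(1)] bounded_ops_mem[OF assms(2)]
        bounded_ops_add[OF assms(1)] bounded_ops_add[OF assms(2)]
        bounded_ops_scale[OF assms(1)] bounded_ops_scale[OF assms(2)]
        bounded_ops_outside[OF assms(2)]\<close>)
qed

lemma bounded_ops_lincomb:
  assumes "T \<in> bounded_ops S" "U \<in> bounded_ops S"
  shows "(\<lambda>f i. c * T f i + d * U f i) \<in> bounded_ops S"
proof -
  obtain K where K: "K \<ge> 0" "\<And>f. f \<in> ell2 S \<Longrightarrow> ell2_norm S (T f) \<le> K * ell2_norm S f"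
    using bounded_ops_bound[OF assms(1)] by blast
  obtain L where L: "L \<ge> 0" "\<And>f. f \<in> ell2 S \<Longrightarrow> ell2_norm S (U f) \<le> L * ell2_norm S f"
    using bounded_ops_bound[OF assms(2)] by blast
  show ?thesis
  proof (rule bounded_opsI[where K = "cmod c * K + cmod d * L"])
    fix f assume f: "f \<in> ell2 S"
    have "ell2_norm S (\<lambda>i. c * T f i + d * U f i)
        \<le> cmod c * ell2_norm S (T f) + cmod d * ell2_norm S (U f)"
      using ell2_norm_triangle[of "\<lambda>i. c * T f i" S "\<lambda>i. d * U f i"] f assms
      by (simp add: bounded_ops_mem ell2_norm_scale)
    also have "\<dots> \<le> cmod c * (K * ell2_norm S f) + cmod d * (L * ell2_norm S f)"
      using K(2)[OF f] L(2)[OF f] by (intro add_mono mult_left_mono) auto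
    finally show "ell2_norm S (\<lambda>i. c * T f i + d * U f i)
        \<le> (cmod c * K + cmod d * L) * ell2_norm S f" by (simp add: algebra_simps)
  qed (auto simp: bounded_ops_mem[OF assms(1)] bounded_ops_mem[OF assms(2)]
        bounded_ops_add[OF assms(1)] bounded_ops_add[OF assms(2)]
        bounded_ops_scale[OF assms(1)] bounded_ops_scale[OF assms(2)]
        bounded_ops_outside[OF assms(1)] bounded_ops_outside[OF assms(2)] algebra_simps)
qed

lemma op_diff_bounded:
  assumes "T \<in> bounded_ops S" "U \<in> bounded_ops S"
  shows "op_diff T U \<in> bounded_ops S"
  using bounded_ops_lincomb[OF assms, of 1 "-1"] by (simp add: op_diff_def)

lemma op_id_bounded: "op_id S \<in> bounded_ops S"
  by (rule bounded_opsI[where K = 1]) (auto simp: op_id_def)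

text \<open>
  Finitely supported functions are dense; this is what extends the adjoint identity from finite
  sums of unit vectors to all of the Hilbert space.
\<close>

lemma ell2_approx:
  assumes f: "f \<in> ell2 S" and "e > 0"
  obtains F where "finite F" "F \<subseteq> S" "ell2_norm S (\<lambda>i. f i - (if i \<in> F then f i else 0)) \<le> e"
proof -
  let ?q = "\<lambda>i. (cmod (f i))\<^sup>2"
  obtain F where F: "finite F" "F \<subseteq> S" "dist (sum ?q F) (infsum ?q S) \<le> e\<^sup>2"
    using infsum_finite_approximation[OF ell2_summable[OF f], of "e\<^sup>2"] \<open>e > 0\<close> by auto
  have "infsum ?q (S - F) = infsum ?q S - infsum ?q F"
    by (rule infsum_Diff) (use F ell2_summable[OF f] in auto)
  also have "\<dots> \<le> e\<^sup>2"
    using F by (simp add: dist_real_def abs_le_iff)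
  also have "infsum ?q (S - F) = (ell2_norm S (\<lambda>i. f i - (if i \<in> F then f i else 0)))\<^sup>2"
    unfolding ell2_norm_square
    by (rule infsum_cong_neutral) auto
  finally have "ell2_norm S (\<lambda>i. f i - (if i \<in> F then f i else 0)) \<le> e"
    by (rule power2_le_imp_le) (use \<open>e > 0\<close> in simp)
  with F that show ?thesis by blast
qed

text \<open>
  The adjoint of \<open>T\<close>, written down explicitly: the \<open>i\<close>-th coefficient of \<open>T\<^sup>*g\<close> can only be
  \<open>\<langle>T\<^sup>*g, \<delta>\<^sub>i\<rangle> = \<langle>g, T\<delta>\<^sub>i\<rangle>\<close>.  This gives existence of adjoints without a representation theorem
  for functionals.
\<close>

definition adjoint_coeffs :: "'i set \<Rightarrow> 'i ell2_op \<Rightarrow> 'i ell2_op" where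
  "adjoint_coeffs S T = (\<lambda>g. if g \<in> ell2 S
     then (\<lambda>i. if i \<in> S then ell2_inner S g (T (ell2_delta i)) else 0) else (\<lambda>_. 0))"

lemma bounded_ops_finite_sum:
  assumes T: "T \<in> bounded_ops S" and "finite F" "F \<subseteq> S"
  shows "T (\<lambda>i. if i \<in> F then f i else 0) = (\<lambda>x. \<Sum>i\<in>F. f i * T (ell2_delta i) x)"
  using assms(2,3)
proof (induction F)
  case empty
  then show ?case using bounded_ops_scale[OF T ell2_zero, of 0] by simp
next
  case (insert j F)
  have eq: "(\<lambda>i. if i \<in> insert j F then f i else 0)
      = (\<lambda>i. f j * ell2_delta j i + (if i \<in> F then f i else 0))"
    using insert.hyps by (auto simp: ell2_delta_def)
  have fin: "(\<lambda>i. if i \<in> F then f i else 0) \<in> ell2 S"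
    by (rule ell2_finite_support[of F]) (use insert in auto)
  show ?case
    unfolding eq using insert T fin
    by (subst bounded_ops_add[OF T]) (auto simp: bounded_ops_scale[OF T])
qed

lemma ell2_inner_finite_sum_left:
  assumes "finite F" "\<And>j. j \<in> F \<Longrightarrow> h j \<in> ell2 S" "g \<in> ell2 S"
  shows "(\<lambda>x. \<Sum>j\<in>F. c j * h j x) \<in> ell2 S \<and>
    ell2_inner S (\<lambda>x. \<Sum>j\<in>F. c j * h j x) g = (\<Sum>j\<in>F. c j * ell2_inner S (h j) g)"
  using assms(1,2)
proof (induction F)
  case empty
  then show ?case by (simp add: ell2_inner_def)
next
  case (insert j F)
  then show ?case
    using assms(3) ell2_inner_add_left[of "\<lambda>x. c j * h j x" S "\<lambda>x. \<Sum>j\<in>F. c j * h j x" g]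
    by (simp add: ell2_inner_scale_left)
qed

lemma adjoint_coeffs_finite:
  assumes T: "T \<in> bounded_ops S" and g: "g \<in> ell2 S" and F: "finite F" "F \<subseteq> S"
  shows "ell2_inner S (T (\<lambda>i. if i \<in> F then f i else 0)) g
    = (\<Sum>i\<in>F. f i * cnj (adjoint_coeffs S T g i))"
proof -
  have "ell2_inner S (T (\<lambda>i. if i \<in> F then f i else 0)) g
      = (\<Sum>i\<in>F. f i * ell2_inner S (T (ell2_delta i)) g)"
    unfolding bounded_ops_finite_sum[OF T F]
    using ell2_inner_finite_sum_left[of F "\<lambda>i. T (ell2_delta i)" S g f] F g T
      bounded_ops_mem[OF T ell2_delta_mem] by blast
  also have "\<dots> = (\<Sum>i\<in>F. f i * cnj (adjoint_coeffs S T g i))"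
    using F g by (intro sum.cong) (auto simp: adjoint_coeffs_def ell2_inner_commute[of S g])
  finally show ?thesis .
qed

text \<open>
  Test \<open>T\<close> on the truncation \<open>h\<close> of the coefficient function itself to \<open>F\<close>: then
  \<open>\<parallel>h\<parallel>\<^sup>2 = \<langle>T h, g\<rangle> \<le> K \<parallel>h\<parallel> \<parallel>g\<parallel>\<close>, which bounds \<open>\<parallel>h\<parallel>\<close> independently of \<open>F\<close>.
\<close>

lemma adjoint_coeffs_bound:
  assumes T: "T \<in> bounded_ops S" and g: "g \<in> ell2 S" and F: "finite F" "F \<subseteq> S"
    and K: "K \<ge> 0" "\<And>f. f \<in> ell2 S \<Longrightarrow> ell2_norm S (T f) \<le> K * ell2_norm S f"
  shows "(\<Sum>i\<in>F. (cmod (adjoint_coeffs S T g i))\<^sup>2) \<le> (K * ell2_norm S g)\<^sup>2"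
proof -
  define t where "t = adjoint_coeffs S T g"
  define h where "h = (\<lambda>i. if i \<in> F then t i else 0)"
  have h: "h \<in> ell2 S"
    by (rule ell2_finite_support[of F]) (use F in \<open>auto simp: h_def\<close>)
  have n: "(ell2_norm S h)\<^sup>2 = (\<Sum>i\<in>F. (cmod (t i))\<^sup>2)"
  proof -
    have "(ell2_norm S h)\<^sup>2 = (\<Sum>\<^sub>\<infinity>i\<in>F. (cmod (t i))\<^sup>2)"
      unfolding ell2_norm_square
      by (rule infsum_cong_neutral) (use F in \<open>auto simp: h_def\<close>)
    with F show ?thesis by simp
  qed
  have "complex_of_real ((ell2_norm S h)\<^sup>2) = ell2_inner S (T h) g"
    unfolding n unfolding h_def adjoint_coeffs_finite[OF T g F] t_def[symmetric] of_real_sum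
    by (simp add: complex_norm_square del: of_real_power)
  then have "(ell2_norm S h)\<^sup>2 = cmod (ell2_inner S (T h) g)"
    by (metis norm_of_real abs_of_nonneg zero_le_power2)
  also have "\<dots> \<le> ell2_norm S (T h) * ell2_norm S g"
    by (rule ell2_cauchy_schwarz[OF bounded_ops_mem[OF T h] g])
  also have "\<dots> \<le> (K * ell2_norm S h) * ell2_norm S g"
    using K(2)[OF h] by (rule mult_right_mono) simp
  finally have "ell2_norm S h * ell2_norm S h \<le> ell2_norm S h * (K * ell2_norm S g)"
    by (simp add: power2_eq_square algebra_simps)
  then have "ell2_norm S h \<le> K * ell2_norm S g"
    using K(1) ell2_norm_nonneg[of S h] ell2_norm_nonneg[of S g]
    by (cases "ell2_norm S h = 0") auto
  then show ?thesis
    unfolding t_def[symmetric] n[symmetric] by (rule power_mono) simp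
qed

lemma adjoint_coeffs_mem:
  assumes T: "T \<in> bounded_ops S" and g: "g \<in> ell2 S"
    and K: "K \<ge> 0" "\<And>f. f \<in> ell2 S \<Longrightarrow> ell2_norm S (T f) \<le> K * ell2_norm S f"
  shows "adjoint_coeffs S T g \<in> ell2 S" "ell2_norm S (adjoint_coeffs S T g) \<le> K * ell2_norm S g"
proof -
  let ?q = "\<lambda>i. (cmod (adjoint_coeffs S T g i))\<^sup>2"
  have s: "?q summable_on S"
    by (rule nonneg_bdd_above_summable_on)
      (use adjoint_coeffs_bound[OF T g _ _ K] in \<open>auto intro!: bdd_aboveI2\<close>)
  then show "adjoint_coeffs S T g \<in> ell2 S"
    by (rule ell2_memI) (auto simp: adjoint_coeffs_def)
  have "(ell2_norm S (adjoint_coeffs S T g))\<^sup>2 \<le> (K * ell2_norm S g)\<^sup>2"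
    unfolding ell2_norm_square
    by (rule infsum_le_finite_sums[OF s]) (use adjoint_coeffs_bound[OF T g _ _ K] in auto)
  then show "ell2_norm S (adjoint_coeffs S T g) \<le> K * ell2_norm S g"
    by (rule power2_le_imp_le) (use K in simp)
qed

lemma adjoint_coeffs_bounded:
  assumes T: "T \<in> bounded_ops S"
  shows "adjoint_coeffs S T \<in> bounded_ops S"
proof -
  obtain K where K: "K \<ge> 0" "\<And>f. f \<in> ell2 S \<Longrightarrow> ell2_norm S (T f) \<le> K * ell2_norm S f"
    using bounded_ops_bound[OF T] by blast
  note TD = bounded_ops_mem[OF T ell2_delta_mem]
  show ?thesis
  proof (rule bounded_opsI[where K = K])
    fix f g assume "f \<in> ell2 S" "g \<in> ell2 S"
    then show "adjoint_coeffs S T (\<lambda>i. f i + g i)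
        = (\<lambda>i. adjoint_coeffs S T f i + adjoint_coeffs S T g i)"
      by (auto simp: adjoint_coeffs_def ell2_inner_add_left[OF _ _ TD])
  next
    fix c f assume "f \<in> ell2 S"
    then show "adjoint_coeffs S T (\<lambda>i. c * f i) = (\<lambda>i. c * adjoint_coeffs S T f i)"
      by (auto simp: adjoint_coeffs_def ell2_inner_scale_left)
  qed (use adjoint_coeffs_mem[OF T _ K] in \<open>auto simp: adjoint_coeffs_def\<close>)
qed

text \<open>
  Both sides agree on finitely supported functions, and both are continuous in \<open>f\<close>.  The constant
  \<open>C\<close> in the proof bounds the sum of the norms of the two functionals; the added \<open>1\<close> makes it
  positive.
\<close>

lemma adjoint_coeffs_inner:
  assumes T: "T \<in> bounded_ops S" and f: "f \<in> ell2 S" and g: "g \<in> ell2 S"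
  shows "ell2_inner S (T f) g = ell2_inner S f (adjoint_coeffs S T g)"
proof -
  obtain K where K: "K \<ge> 0" "\<And>f. f \<in> ell2 S \<Longrightarrow> ell2_norm S (T f) \<le> K * ell2_norm S f"
    using bounded_ops_bound[OF T] by blast
  define t where "t = adjoint_coeffs S T g"
  have t: "t \<in> ell2 S" "ell2_norm S t \<le> K * ell2_norm S g"
    unfolding t_def using adjoint_coeffs_mem[OF T g K] by auto
  define C where "C = 2 * K * ell2_norm S g + 1"
  have C: "C > 0" using K(1) by (simp add: C_def add_nonneg_pos)
  have "cmod (ell2_inner S (T f) g - ell2_inner S f t) \<le> e" if e: "e > 0" for e
  proof -
    obtain F where F: "finite F" "F \<subseteq> S"
      and small: "ell2_norm S (\<lambda>i. f i - (if i \<in> F then f i else 0)) \<le> e / C"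
      using ell2_approx[OF f, of "e / C"] e C by auto
    define h where "h = (\<lambda>i. if i \<in> F then f i else 0)"
    define r where "r = (\<lambda>i. f i - h i)"
    have h: "h \<in> ell2 S"
      by (rule ell2_finite_support[of F]) (use F in \<open>auto simp: h_def\<close>)
    have r: "r \<in> ell2 S" unfolding r_def using f h by simp
    have hh: "ell2_inner S (T h) g = ell2_inner S h t"
    proof -
      have "ell2_inner S h t = (\<Sum>\<^sub>\<infinity>i\<in>F. f i * cnj (t i))"
        unfolding ell2_inner_def
        by (rule infsum_cong_neutral) (use F in \<open>auto simp: h_def\<close>)
      then show ?thesis
        using adjoint_coeffs_finite[OF T g F, of f] F by (simp add: h_def t_def)
    qed
    have "ell2_inner S (T r) g = ell2_inner S (T f) g - ell2_inner S (T h) g"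
      unfolding r_def bounded_ops_diff[OF T f h]
      by (rule ell2_inner_diff_left) (use T f h g in \<open>auto intro: bounded_ops_mem\<close>)
    moreover have "ell2_inner S r t = ell2_inner S f t - ell2_inner S h t"
      unfolding r_def by (rule ell2_inner_diff_left) (use f h t in auto)
    ultimately have "ell2_inner S (T f) g - ell2_inner S f t = ell2_inner S (T r) g - ell2_inner S r t"
      using hh by simp
    then have "cmod (ell2_inner S (T f) g - ell2_inner S f t)
        \<le> cmod (ell2_inner S (T r) g) + cmod (ell2_inner S r t)"
      by (simp add: norm_triangle_ineq4)
    also have "\<dots> \<le> ell2_norm S (T r) * ell2_norm S g + ell2_norm S r * ell2_norm S t"
      by (intro add_mono ell2_cauchy_schwarz bounded_ops_mem[OF T] r g t)
    also have "\<dots> \<le> (K * ell2_norm S r) * ell2_norm S g + ell2_norm S r * (K * ell2_norm S g)"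
      using K(2)[OF r] t(2) by (intro add_mono mult_right_mono mult_left_mono) auto
    also have "\<dots> \<le> C * ell2_norm S r"
      by (simp add: C_def algebra_simps)
    also have "\<dots> \<le> C * (e / C)"
      using small C by (intro mult_left_mono) (auto simp: r_def h_def)
    finally show ?thesis using C by simp
  qed
  then have "cmod (ell2_inner S (T f) g - ell2_inner S f t) \<le> 0"
    by (rule field_le_epsilon[of _ 0, simplified])
  then show ?thesis by (simp add: t_def)
qed

lemma ell2_eqI:
  assumes "f \<in> ell2 S" "g \<in> ell2 S" "\<And>h. h \<in> ell2 S \<Longrightarrow> ell2_inner S h f = ell2_inner S h g"
  shows "f = g"
proof
  fix i
  show "f i = g i"
  proof (cases "i \<in> S")
    case True
    then show ?thesis
      using assms(3)[of "ell2_delta i"] by (simp add: ell2_inner_delta_left)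
  qed (use assms in \<open>simp add: ell2_outside\<close>)
qed

lemma op_adjoint_unique:
  assumes U: "U \<in> bounded_ops S"
    and UT: "\<And>f g. f \<in> ell2 S \<Longrightarrow> g \<in> ell2 S \<Longrightarrow> ell2_inner S (T f) g = ell2_inner S f (U g)"
  shows "op_adjoint S T = U"
  unfolding op_adjoint_def
proof (rule the_equality)
  fix V assume V: "V \<in> bounded_ops S \<and>
    (\<forall>f\<in>ell2 S. \<forall>g\<in>ell2 S. ell2_inner S (T f) g = ell2_inner S f (V g))"
  show "V = U"
  proof
    fix g
    show "V g = U g"
    proof (cases "g \<in> ell2 S")
      case True
      then show ?thesis
        using U V UT by (intro ell2_eqI[of _ S]) (auto intro: bounded_ops_mem)
    qed (use U V in \<open>auto simp: bounded_ops_outside\<close>)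
  qed
qed (use assms in auto)

lemma op_adjoint_eq_coeffs: "T \<in> bounded_ops S \<Longrightarrow> op_adjoint S T = adjoint_coeffs S T"
  by (rule op_adjoint_unique) (auto intro: adjoint_coeffs_bounded adjoint_coeffs_inner)

lemma op_adjoint_bounded: "T \<in> bounded_ops S \<Longrightarrow> op_adjoint S T \<in> bounded_ops S"
  by (simp add: op_adjoint_eq_coeffs adjoint_coeffs_bounded)

lemma op_adjoint_inner:
  assumes "T \<in> bounded_ops S" "f \<in> ell2 S" "g \<in> ell2 S"
  shows "ell2_inner S (T f) g = ell2_inner S f (op_adjoint S T g)"
  using assms by (simp add: op_adjoint_eq_coeffs adjoint_coeffs_inner)

lemma op_adjoint_inner':
  assumes "T \<in> bounded_ops S" "f \<in> ell2 S" "g \<in> ell2 S"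
  shows "ell2_inner S (op_adjoint S T f) g = ell2_inner S f (T g)"
  by (metis op_adjoint_inner[OF assms(1,3,2)] ell2_inner_commute)

lemma op_adjoint_adjoint: "T \<in> bounded_ops S \<Longrightarrow> op_adjoint S (op_adjoint S T) = T"
  by (rule op_adjoint_unique) (auto simp: op_adjoint_inner')

lemma op_adjoint_comp:
  assumes "T \<in> bounded_ops S" "U \<in> bounded_ops S"
  shows "op_adjoint S (T \<circ> U) = op_adjoint S U \<circ> op_adjoint S T"
  by (rule op_adjoint_unique)
    (use assms in \<open>auto intro!: bounded_ops_comp op_adjoint_bounded
       simp: op_adjoint_inner bounded_ops_mem op_adjoint_bounded\<close>)

lemma bounded_ops_range: "T \<in> bounded_ops S \<Longrightarrow> T f \<in> ell2 S"
  by (cases "f \<in> ell2 S") (auto simp: bounded_ops_mem bounded_ops_outside)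

lemma op_norm_le_1_iff:
  assumes T: "T \<in> bounded_ops S"
  shows "op_norm S T \<le> 1 \<longleftrightarrow> (\<forall>f\<in>ell2 S. ell2_norm S f \<le> 1 \<longrightarrow> ell2_norm S (T f) \<le> 1)"
proof -
  let ?B = "{f \<in> ell2 S. ell2_norm S f \<le> 1}"
  obtain K where K: "K \<ge> 0" "\<And>f. f \<in> ell2 S \<Longrightarrow> ell2_norm S (T f) \<le> K * ell2_norm S f"
    using bounded_ops_bound[OF T] by blast
  have "bdd_above ((\<lambda>f. ell2_norm S (T f)) ` ?B)"
  proof (rule bdd_aboveI2)
    fix f assume "f \<in> ?B"
    then show "ell2_norm S (T f) \<le> K"
      using K(2)[of f] mult_left_mono[OF _ K(1), of "ell2_norm S f" 1] by auto
  qed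
  moreover have "(\<lambda>_. 0) \<in> ?B" by (simp add: ell2_norm_def)
  then have "?B \<noteq> {}" by blast
  ultimately show ?thesis
    unfolding op_norm_def by (subst cSUP_le_iff) auto
qed

section \<open>Unitaries\<close>

lemma unitary_op_bounded: "unitary_op S u \<Longrightarrow> u \<in> bounded_ops S"
  by (simp add: unitary_op_def)

lemma unitary_op_cancel:
  assumes "unitary_op S u" "f \<in> ell2 S"
  shows "op_adjoint S u (u f) = f" "u (op_adjoint S u f) = f"
  using assms by (auto simp: unitary_op_def op_id_def fun_eq_iff)

lemma unitary_op_norm:
  assumes "unitary_op S u" "f \<in> ell2 S"
  shows "ell2_norm S (u f) = ell2_norm S f" "ell2_norm S (op_adjoint S u f) = ell2_norm S f"
proof -
  note u = unitary_op_bounded[OF assms(1)]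
  have 1: "ell2_norm S (u g) = ell2_norm S g" if g: "g \<in> ell2 S" for g
  proof -
    have "(ell2_norm S (u g))\<^sup>2 = (ell2_norm S g)\<^sup>2"
      unfolding ell2_norm_eq_Re op_adjoint_inner[OF u g bounded_ops_mem[OF u g]]
      by (simp add: unitary_op_cancel[OF assms(1) g])
    then show ?thesis by simp
  qed
  then show "ell2_norm S (u f) = ell2_norm S f" using assms(2) .
  show "ell2_norm S (op_adjoint S u f) = ell2_norm S f"
    using 1[OF bounded_ops_mem[OF op_adjoint_bounded[OF u] assms(2)]]
    by (simp add: unitary_op_cancel[OF assms])
qed

text \<open>
  Conjugation by a unitary preserves the operator norm, so a point of the unit ball of \<open>u X u\<^sup>*\<close> may
  be replaced by a point of the unit ball of \<open>X\<close>.
\<close>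

lemma op_unit_ball_conjugate:
  assumes u: "unitary_op S u" and X: "X \<subseteq> bounded_ops S"
  shows "op_unit_ball S (op_conjugate S u X)
    = (\<lambda>T. u \<circ> T \<circ> op_adjoint S u) ` op_unit_ball S X"
proof -
  note ub = unitary_op_bounded[OF u] and un = unitary_op_norm[OF u] and uc = unitary_op_cancel[OF u]
  note us = op_adjoint_bounded[OF ub]
  have "op_norm S (u \<circ> T \<circ> op_adjoint S u) \<le> 1 \<longleftrightarrow> op_norm S T \<le> 1" if "T \<in> X" for T
  proof -
    have T: "T \<in> bounded_ops S" using that X by blast
    have "(\<forall>f\<in>ell2 S. ell2_norm S f \<le> 1 \<longrightarrow> ell2_norm S (u (T (op_adjoint S u f))) \<le> 1)
      \<longleftrightarrow> (\<forall>f\<in>ell2 S. ell2_norm S f \<le> 1 \<longrightarrow> ell2_norm S (T f) \<le> 1)" (is "?L \<longleftrightarrow> ?R")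
    proof
      assume L: ?L
      show ?R
      proof (intro ballI impI)
        fix f assume "f \<in> ell2 S" "ell2_norm S f \<le> 1"
        then show "ell2_norm S (T f) \<le> 1"
          using L[rule_format, of "u f"]
          by (simp add: un uc bounded_ops_mem[OF ub] bounded_ops_mem[OF T])
      qed
    next
      assume ?R
      then show ?L by (simp add: un bounded_ops_mem[OF us] bounded_ops_mem[OF T])
    qed
    then show ?thesis
      by (simp add: op_norm_le_1_iff T bounded_ops_comp ub us)
  qed
  then show ?thesis by (auto simp: op_unit_ball_def op_conjugate_def)
qed

section \<open>Commutants\<close>

lemma commutant_bounded: "T \<in> commutant S X \<Longrightarrow> T \<in> bounded_ops S"
  by (simp add: commutant_def)

lemma commutant_apply: "T \<in> commutant S X \<Longrightarrow> U \<in> X \<Longrightarrow> T (U f) = U (T f)"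
  by (auto simp: commutant_def fun_eq_iff)

lemma commutantI:
  "T \<in> bounded_ops S \<Longrightarrow> (\<And>U f. U \<in> X \<Longrightarrow> T (U f) = U (T f)) \<Longrightarrow> T \<in> commutant S X"
  by (auto simp: commutant_def fun_eq_iff)

lemma commutant_lincomb:
  assumes "X \<subseteq> bounded_ops S" "T \<in> commutant S X" "U \<in> commutant S X"
  shows "(\<lambda>f i. c * T f i + d * U f i) \<in> commutant S X"
proof (rule commutantI)
  note b = assms(2,3)[THEN commutant_bounded]
  show "(\<lambda>f i. c * T f i + d * U f i) \<in> bounded_ops S"
    using b by (rule bounded_ops_lincomb)
  fix V f assume V: "V \<in> X"
  then have Vb: "V \<in> bounded_ops S" using assms by blast
  show "(\<lambda>i. c * T (V f) i + d * U (V f) i) = V (\<lambda>i. c * T f i + d * U f i)"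
    using b[THEN bounded_ops_range, of f]
    by (simp add: bounded_ops_add[OF Vb] bounded_ops_scale[OF Vb]
        commutant_apply[OF assms(2) V] commutant_apply[OF assms(3) V])
qed

lemma op_id_commutant:
  assumes "X \<subseteq> bounded_ops S"
  shows "op_id S \<in> commutant S X"
proof (rule commutantI)
  fix V f assume "V \<in> X"
  then have Vb: "V \<in> bounded_ops S" using assms by blast
  show "op_id S (V f) = V (op_id S f)"
    using bounded_ops_range[OF Vb] bounded_ops_scale[OF Vb ell2_zero, of 0]
    by (simp add: op_id_def bounded_ops_outside[OF Vb])
qed (rule op_id_bounded)

lemma commutant_comp:
  assumes "T \<in> commutant S X" "U \<in> commutant S X"
  shows "T \<circ> U \<in> commutant S X"
  by (rule commutantI) (auto simp: assms[THEN commutant_apply]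
      bounded_ops_comp[OF assms[THEN commutant_bounded]])

text \<open>
  Taking adjoints in \<open>T U\<^sup>* = U\<^sup>* T\<close> gives \<open>U T\<^sup>* = T\<^sup>* U\<close>.
\<close>

lemma commutant_adjoint:
  assumes X: "X \<subseteq> bounded_ops S" "\<And>U. U \<in> X \<Longrightarrow> op_adjoint S U \<in> X"
    and T: "T \<in> commutant S X"
  shows "op_adjoint S T \<in> commutant S X"
proof -
  note Tb = commutant_bounded[OF T]
  have "op_adjoint S T \<circ> U = U \<circ> op_adjoint S T" if U: "U \<in> X" for U
  proof -
    have Ub: "U \<in> bounded_ops S" using U X by blast
    have "T \<circ> op_adjoint S U = op_adjoint S U \<circ> T"
      using T X(2)[OF U] by (simp add: commutant_def)
    then have "op_adjoint S (T \<circ> op_adjoint S U) = op_adjoint S (op_adjoint S U \<circ> T)"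
      by simp
    then show ?thesis
      by (simp add: op_adjoint_comp op_adjoint_bounded Tb Ub op_adjoint_adjoint)
  qed
  then show ?thesis
    using op_adjoint_bounded[OF Tb] by (simp add: commutant_def)
qed

section \<open>Operators that permute or cut off coordinates\<close>

text \<open>
  Left and right translations of a group are both of this form, so their boundedness, adjoints and
  mutual commutation are consequences of facts about permutations.
\<close>

definition perm_op :: "'i set \<Rightarrow> ('i \<Rightarrow> 'i) \<Rightarrow> 'i ell2_op" where
  "perm_op S p = (\<lambda>f. if f \<in> ell2 S then (\<lambda>x. if x \<in> S then f (p x) else 0) else (\<lambda>_. 0))"

lemma perm_op_norm:
  assumes "bij_betw p S S" "f \<in> ell2 S"
  shows "perm_op S p f \<in> ell2 S" "ell2_norm S (perm_op S p f) = ell2_norm S f"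
proof -
  have "(\<lambda>i. (cmod (f (p i)))\<^sup>2) summable_on S"
    using summable_on_reindex_bij_betw[OF assms(1), of "\<lambda>i. (cmod (f i))\<^sup>2"]
      ell2_summable[OF assms(2)] by simp
  then have "(\<lambda>i. (cmod (perm_op S p f i))\<^sup>2) summable_on S"
    by (rule summable_on_cong[THEN iffD1, rotated]) (simp add: perm_op_def assms)
  then show "perm_op S p f \<in> ell2 S"
    by (rule ell2_memI) (simp add: perm_op_def)
  have "(\<Sum>\<^sub>\<infinity>i\<in>S. (cmod (perm_op S p f i))\<^sup>2) = (\<Sum>\<^sub>\<infinity>i\<in>S. (cmod (f (p i)))\<^sup>2)"
    by (rule infsum_cong) (simp add: perm_op_def assms)
  then show "ell2_norm S (perm_op S p f) = ell2_norm S f"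
    using infsum_reindex_bij_betw[OF assms(1), of "\<lambda>i. (cmod (f i))\<^sup>2"]
    by (simp add: ell2_norm_def)
qed

lemma perm_op_bounded:
  assumes "bij_betw p S S"
  shows "perm_op S p \<in> bounded_ops S"
  by (rule bounded_opsI[where K = 1])
    (use perm_op_norm[OF assms] in \<open>auto simp: perm_op_def\<close>)

lemma perm_op_commute:
  assumes "bij_betw p S S" "bij_betw q S S" "\<And>x. x \<in> S \<Longrightarrow> p (q x) = q (p x)"
  shows "perm_op S p (perm_op S q f) = perm_op S q (perm_op S p f)"
proof (cases "f \<in> ell2 S")
  case f: True
  have "perm_op S r (perm_op S t f) = (\<lambda>x. if x \<in> S then f (t (r x)) else 0)"
    if "bij_betw r S S" "bij_betw t S S" for r t
    using perm_op_norm(1)[OF that(2) f] bij_betwE[OF that(1)] f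
    by (auto simp: perm_op_def)
  then show ?thesis using assms by auto
next
  case False
  then show ?thesis by (simp add: perm_op_def)
qed

lemma perm_op_adjoint:
  assumes p: "bij_betw p S S" and q: "bij_betw q S S" and inv: "\<And>x. x \<in> S \<Longrightarrow> q (p x) = x"
  shows "op_adjoint S (perm_op S p) = perm_op S q"
proof (rule op_adjoint_unique)
  fix f g assume f: "f \<in> ell2 S" and g: "g \<in> ell2 S"
  have "ell2_inner S (perm_op S p f) g = (\<Sum>\<^sub>\<infinity>i\<in>S. f (p i) * cnj (g (q (p i))))"
    unfolding ell2_inner_def by (rule infsum_cong) (simp add: perm_op_def f inv)
  also have "\<dots> = (\<Sum>\<^sub>\<infinity>i\<in>S. f i * cnj (g (q i)))"
    by (rule infsum_reindex_bij_betw[OF p])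
  also have "\<dots> = ell2_inner S f (perm_op S q g)"
    unfolding ell2_inner_def by (rule infsum_cong) (simp add: perm_op_def g)
  finally show "ell2_inner S (perm_op S p f) g = ell2_inner S f (perm_op S q g)" .
qed (rule perm_op_bounded[OF q])

text \<open>
  The orthogonal projection onto the functions supported in \<open>H\<close>.
\<close>

definition cutoff :: "'i set \<Rightarrow> 'i set \<Rightarrow> 'i ell2_op" where
  "cutoff S H = (\<lambda>f. if f \<in> ell2 S then (\<lambda>x. if x \<in> H then f x else 0) else (\<lambda>_. 0))"

lemma cutoff_bounded: "cutoff S H \<in> bounded_ops S"
proof (rule bounded_opsI[where K = 1])
  fix f assume f: "f \<in> ell2 S"
  then show m: "cutoff S H f \<in> ell2 S"
    by (rule ell2_comparison) (auto simp: cutoff_def f ell2_outside[OF f])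
  have "(ell2_norm S (cutoff S H f))\<^sup>2 \<le> (ell2_norm S f)\<^sup>2"
    unfolding ell2_norm_square
    by (rule infsum_mono[OF ell2_summable[OF m] ell2_summable[OF f]]) (simp add: cutoff_def f)
  then show "ell2_norm S (cutoff S H f) \<le> 1 * ell2_norm S f"
    unfolding mult_1 by (rule power2_le_imp_le) simp
qed (auto simp: cutoff_def)

section \<open>Group von Neumann algebras\<close>

definition right_translation :: "('g, 'm) monoid_scheme \<Rightarrow> 'g \<Rightarrow> 'g ell2_op" where
  "right_translation G g = perm_op (carrier G) (\<lambda>x. x \<otimes>\<^bsub>G\<^esub> g)"

context group
begin

text \<open>
  This algebra contains every \<open>L(H)\<close> and is visibly closed under products, so operators such as
  \<open>z u\<^sup>*\<close>, whose factors belong to different subgroups, can be treated as convolution operators too.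
\<close>

abbreviation right_commutant :: "'a ell2_op set" where
  "right_commutant \<equiv> commutant (carrier G) (right_translation G ` carrier G)"

lemma left_translation_perm: "left_translation G g = perm_op (carrier G) (\<lambda>x. inv g \<otimes> x)"
  by (simp add: left_translation_def perm_op_def)

lemma bij_left_mult: "g \<in> carrier G \<Longrightarrow> bij_betw (\<lambda>x. g \<otimes> x) (carrier G) (carrier G)"
  by (rule bij_betwI[where g = "\<lambda>x. inv g \<otimes> x"]) (auto simp: m_assoc[symmetric])

lemma bij_right_mult: "g \<in> carrier G \<Longrightarrow> bij_betw (\<lambda>x. x \<otimes> g) (carrier G) (carrier G)"
  by (rule bij_betwI[where g = "\<lambda>x. x \<otimes> inv g"]) (auto simp: m_assoc)

lemma left_translation_bounded:
  "g \<in> carrier G \<Longrightarrow> left_translation G g \<in> bounded_ops (carrier G)"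
  by (simp add: left_translation_perm perm_op_bounded bij_left_mult)

lemma right_translation_bounded:
  "g \<in> carrier G \<Longrightarrow> right_translation G g \<in> bounded_ops (carrier G)"
  by (simp add: right_translation_def perm_op_bounded bij_right_mult)

lemma left_translation_adjoint:
  "g \<in> carrier G \<Longrightarrow> op_adjoint (carrier G) (left_translation G g) = left_translation G (inv g)"
  unfolding left_translation_perm
  by (rule perm_op_adjoint) (auto simp: bij_left_mult m_assoc[symmetric])

lemma left_translation_delta_one:
  assumes "g \<in> carrier G"
  shows "left_translation G g (ell2_delta \<one>) = ell2_delta g"
proof -
  have "inv g \<otimes> x = \<one> \<longleftrightarrow> x = g" if "x \<in> carrier G" for x
    using inv_solve_left'[of \<one> g x] assms that by simp
  then show ?thesis
    using assms by (auto simp: left_translation_def ell2_delta_def[of g]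
        ell2_delta_def[of \<one>, THEN fun_cong] fun_eq_iff)
qed

lemma right_translation_delta_one:
  assumes "g \<in> carrier G"
  shows "right_translation G (inv g) (ell2_delta \<one>) = ell2_delta g"
proof -
  have "x \<otimes> inv g = \<one> \<longleftrightarrow> x = g" if "x \<in> carrier G" for x
    using inv_solve_right'[of \<one> x g] assms that by simp
  then show ?thesis
    using assms by (auto simp: right_translation_def perm_op_def ell2_delta_def[of g]
        ell2_delta_def[of \<one>, THEN fun_cong] fun_eq_iff)
qed

text \<open>
  Right translations commute with left translations, hence lie in the commutant over which the
  double commutant is formed.
\<close>

lemma group_vN_right_commutant:
  assumes H: "H \<subseteq> carrier G" and T: "T \<in> group_vN G H"
  shows "T \<in> right_commutant"
proof (rule commutantI)
  show "T \<in> bounded_ops (carrier G)"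
    using T unfolding group_vN_def by (rule commutant_bounded)
  fix U f assume "U \<in> right_translation G ` carrier G"
  then obtain g where g: "g \<in> carrier G" and U: "U = right_translation G g" by blast
  have "U \<in> commutant (carrier G) (left_translation G ` H)"
  proof (rule commutantI)
    fix V f assume "V \<in> left_translation G ` H"
    then obtain h where h: "h \<in> carrier G" and V: "V = left_translation G h" using H by blast
    show "U (V f) = V (U f)"
      unfolding U V left_translation_perm right_translation_def
      by (rule perm_op_commute) (auto simp: g h bij_left_mult bij_right_mult m_assoc)
  qed (simp add: U g right_translation_bounded)
  then show "T (U f) = U (T f)"
    using T unfolding group_vN_def by (rule commutant_apply[rotated])
qed

lemma left_translation_group_vN:
  assumes H: "H \<subseteq> carrier G" and h: "h \<in> H"
  shows "left_translation G h \<in> group_vN G H"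
  unfolding group_vN_def
proof (rule commutantI)
  show "left_translation G h \<in> bounded_ops (carrier G)"
    using h H by (auto intro: left_translation_bounded)
  fix U f assume "U \<in> commutant (carrier G) (left_translation G ` H)"
  then show "left_translation G h (U f) = U (left_translation G h f)"
    using commutant_apply[of U _ _ "left_translation G h"] h by simp
qed

lemma group_vN_lincomb:
  assumes "T \<in> group_vN G H" "U \<in> group_vN G H"
  shows "(\<lambda>f i. c * T f i + d * U f i) \<in> group_vN G H"
  using assms unfolding group_vN_def
  by (intro commutant_lincomb) (auto intro: commutant_bounded)

lemma op_id_group_vN: "op_id (carrier G) \<in> group_vN G H"
  unfolding group_vN_def by (rule op_id_commutant) (auto intro: commutant_bounded)

text \<open>
  The inverse of a left translation by \<open>h\<close> is its adjoint, so the generating set is closed under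
  adjoints; this property passes to the commutant, and then to the double commutant.
\<close>

lemma group_vN_adjoint:
  assumes H: "subgroup H G" and T: "T \<in> group_vN G H"
  shows "op_adjoint (carrier G) T \<in> group_vN G H"
  using T unfolding group_vN_def
proof (rule commutant_adjoint[rotated 2])
  fix U assume "U \<in> commutant (carrier G) (left_translation G ` H)"
  then show "op_adjoint (carrier G) U \<in> commutant (carrier G) (left_translation G ` H)"
    by (rule commutant_adjoint[rotated 2])
      (use subgroup.mem_carrier[OF H] subgroup.m_inv_closed[OF H] in
        \<open>auto simp: left_translation_bounded left_translation_adjoint\<close>)
qed (auto intro: commutant_bounded)

text \<open>
  \<open>\<delta>\<^sub>g\<close> is a right translate of \<open>\<delta>\<^sub>e\<close>.
\<close>

lemma right_commutant_delta:
  assumes T: "T \<in> right_commutant" and g: "g \<in> carrier G" and x: "x \<in> carrier G"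
  shows "T (ell2_delta g) x = T (ell2_delta \<one>) (x \<otimes> inv g)"
proof -
  have m: "T (ell2_delta \<one>) \<in> ell2 (carrier G)"
    by (rule bounded_ops_range[OF commutant_bounded[OF T]])
  have "T (ell2_delta g) = right_translation G (inv g) (T (ell2_delta \<one>))"
    unfolding right_translation_delta_one[OF g, symmetric]
    by (rule commutant_apply[OF T]) (use g in auto)
  with m x show ?thesis by (simp add: right_translation_def perm_op_def)
qed

lemma adjoint_delta:
  assumes T: "T \<in> bounded_ops (carrier G)" and g: "g \<in> carrier G" "x \<in> carrier G"
  shows "op_adjoint (carrier G) T (ell2_delta x) g = cnj (T (ell2_delta g) x)"
  using assms by (simp add: op_adjoint_eq_coeffs adjoint_coeffs_def ell2_inner_delta_left)

text \<open>
  \<open>(T f)(x) = \<langle>f, T\<^sup>*\<delta>\<^sub>x\<rangle>\<close>, and the coefficients of \<open>T\<^sup>*\<delta>\<^sub>x\<close> are those of the vectors \<open>T\<delta>\<^sub>g\<close>.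
  Passing through the adjoint avoids an interchange of \<open>T\<close> with an infinite sum.
\<close>

lemma right_commutant_convolution:
  assumes T: "T \<in> right_commutant" and f: "f \<in> ell2 (carrier G)" and x: "x \<in> carrier G"
  shows "T f x = (\<Sum>\<^sub>\<infinity>g\<in>carrier G. f g * T (ell2_delta \<one>) (x \<otimes> inv g))"
proof -
  note Tb = commutant_bounded[OF T]
  have "T f x = ell2_inner (carrier G) f (op_adjoint (carrier G) T (ell2_delta x))"
    using op_adjoint_inner[OF Tb f ell2_delta_mem[OF x]] x by (simp add: ell2_inner_delta_right)
  also have "\<dots> = (\<Sum>\<^sub>\<infinity>g\<in>carrier G. f g * T (ell2_delta \<one>) (x \<otimes> inv g))"
    unfolding ell2_inner_def
    by (rule infsum_cong) (simp add: adjoint_delta[OF Tb _ x] right_commutant_delta[OF T _ x])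
  finally show ?thesis .
qed

lemma right_commutant_adjoint_delta_one:
  assumes T: "T \<in> right_commutant" and x: "x \<in> carrier G"
  shows "op_adjoint (carrier G) T (ell2_delta \<one>) x = cnj (T (ell2_delta \<one>) (inv x))"
  using adjoint_delta[OF commutant_bounded[OF T] x one_closed]
    right_commutant_delta[OF T x one_closed] x by simp

text \<open>
  This is the trace property \<open>\<tau>(T T\<^sup>*) = \<tau>(T\<^sup>* T)\<close>: the coefficients of \<open>T\<^sup>*\<delta>\<^sub>e\<close> are the conjugates
  of those of \<open>T\<delta>\<^sub>e\<close>, permuted by inversion.
\<close>

lemma right_commutant_adjoint_norm:
  assumes T: "T \<in> right_commutant"
  shows "ell2_norm (carrier G) (op_adjoint (carrier G) T (ell2_delta \<one>))
    = ell2_norm (carrier G) (T (ell2_delta \<one>))"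
proof -
  have b: "bij_betw (\<lambda>x. inv x) (carrier G) (carrier G)"
    by (rule bij_betwI[where g = "\<lambda>x. inv x"]) auto
  have "(\<Sum>\<^sub>\<infinity>x\<in>carrier G. (cmod (op_adjoint (carrier G) T (ell2_delta \<one>) x))\<^sup>2)
      = (\<Sum>\<^sub>\<infinity>x\<in>carrier G. (cmod (T (ell2_delta \<one>) (inv x)))\<^sup>2)"
    by (rule infsum_cong) (simp add: right_commutant_adjoint_delta_one[OF T])
  then show ?thesis
    using infsum_reindex_bij_betw[OF b, of "\<lambda>x. (cmod (T (ell2_delta \<one>) x))\<^sup>2"]
    by (simp add: ell2_norm_def)
qed

text \<open>
  The projection onto \<open>\<ell>\<^sup>2(H)\<close> commutes with translations by \<open>H\<close>, so it commutes with \<open>T\<close>, and it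
  fixes \<open>\<delta>\<^sub>e\<close>.
\<close>

lemma group_vN_support:
  assumes H: "subgroup H G" and T: "T \<in> group_vN G H" and x: "x \<notin> H"
  shows "T (ell2_delta \<one>) x = 0"
proof -
  let ?S = "carrier G"
  have Hc: "H \<subseteq> ?S" using H by (rule subgroup.subset)
  have "cutoff ?S H \<in> commutant ?S (left_translation G ` H)"
  proof (rule commutantI[OF cutoff_bounded])
    fix U f assume "U \<in> left_translation G ` H"
    then obtain h where h: "h \<in> H" and U: "U = left_translation G h" by blast
    have hc: "h \<in> ?S" using h Hc by blast
    note Ub = left_translation_bounded[OF hc, folded U]
    show "cutoff ?S H (U f) = U (cutoff ?S H f)"
    proof (cases "f \<in> ell2 ?S")
      case f: True
      have iff: "inv h \<otimes> x \<in> H \<longleftrightarrow> x \<in> H" if x: "x \<in> ?S" for x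
      proof
        assume "inv h \<otimes> x \<in> H"
        then have "h \<otimes> (inv h \<otimes> x) \<in> H" by (rule subgroup.m_closed[OF H h])
        then show "x \<in> H" using x hc by (simp add: m_assoc[symmetric])
      qed (rule subgroup.m_closed[OF H subgroup.m_inv_closed[OF H h]])
      have m: "U f \<in> ell2 ?S" "cutoff ?S H f \<in> ell2 ?S"
        using bounded_ops_mem[OF Ub f] bounded_ops_mem[OF cutoff_bounded f] .
      have "cutoff ?S H (U f) = (\<lambda>x. if x \<in> H then U f x else 0)"
        using m by (simp add: cutoff_def)
      also have "\<dots> = (\<lambda>x. if x \<in> ?S then cutoff ?S H f (inv h \<otimes> x) else 0)"
        using f Hc by (auto simp: U left_translation_def iff cutoff_def fun_eq_iff)
      also have "\<dots> = U (cutoff ?S H f)"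
        using m by (simp add: U left_translation_def)
      finally show ?thesis .
    next
      case False
      then show ?thesis
        using bounded_ops_scale[OF Ub ell2_zero, of 0]
        by (simp add: bounded_ops_outside[OF Ub] cutoff_def)
    qed
  qed
  then have "T (cutoff ?S H (ell2_delta \<one>)) = cutoff ?S H (T (ell2_delta \<one>))"
    using T unfolding group_vN_def by (rule commutant_apply[rotated])
  moreover have "cutoff ?S H (ell2_delta \<one>) = ell2_delta \<one>"
    using subgroup.one_closed[OF H]
    by (auto simp: cutoff_def ell2_delta_def[of \<one>, THEN fun_cong])
  ultimately have "T (ell2_delta \<one>) x = cutoff ?S H (T (ell2_delta \<one>)) x" by simp
  with x show ?thesis by (simp add: cutoff_def)
qed

text \<open>
  In the convolution of \<open>T\<delta>\<^sub>e\<close>, which is supported in \<open>H\<close>, with a function supported in \<open>K\<close>, only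
  one term contributes at \<open>h k\<close>, since a product \<open>h k\<close> determines both factors when \<open>H\<close> and \<open>K\<close>
  have trivial intersection.
\<close>

lemma group_vN_apply_product:
  assumes H: "subgroup H G" and K: "subgroup K G" and HK: "H \<inter> K = {\<one>}"
    and T: "T \<in> group_vN G H" and f: "f \<in> ell2 (carrier G)" "\<And>x. x \<notin> K \<Longrightarrow> f x = 0"
    and h: "h \<in> H" and k: "k \<in> K"
  shows "T f (h \<otimes> k) = T (ell2_delta \<one>) h * f k"
proof -
  note Hc = subgroup.mem_carrier[OF H] and Kc = subgroup.mem_carrier[OF K]
  note c = Hc[OF h] Kc[OF k]
  have Tr: "T \<in> right_commutant"
    by (rule group_vN_right_commutant[OF subgroup.subset[OF H] T])
  have z: "f g * T (ell2_delta \<one>) (h \<otimes> k \<otimes> inv g) = 0" if g: "g \<in> carrier G" "g \<noteq> k" for g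
  proof (rule ccontr)
    assume *: "f g * T (ell2_delta \<one>) (h \<otimes> k \<otimes> inv g) \<noteq> 0"
    then have gK: "g \<in> K" using f(2) by force
    have "h \<otimes> k \<otimes> inv g \<in> H" using * group_vN_support[OF H T] by force
    then have "inv h \<otimes> (h \<otimes> k \<otimes> inv g) \<in> H"
      by (rule subgroup.m_closed[OF H subgroup.m_inv_closed[OF H h]])
    also have "inv h \<otimes> (h \<otimes> k \<otimes> inv g) = k \<otimes> inv g"
      using c g by (simp add: m_assoc[symmetric])
    finally have "k \<otimes> inv g \<in> H \<inter> K"
      using subgroup.m_closed[OF K k subgroup.m_inv_closed[OF K gK]] by simp
    then have "k \<otimes> inv g = \<one>" unfolding HK by simp
    then have "k = g" using inv_solve_right'[of \<one> k g] c g by simp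
    with g show False by simp
  qed
  have "T f (h \<otimes> k) = (\<Sum>\<^sub>\<infinity>g\<in>carrier G. f g * T (ell2_delta \<one>) (h \<otimes> k \<otimes> inv g))"
    by (rule right_commutant_convolution[OF Tr f(1)]) (simp add: c)
  also have "\<dots> = (\<Sum>\<^sub>\<infinity>g\<in>{k}. f g * T (ell2_delta \<one>) (h \<otimes> k \<otimes> inv g))"
    by (rule infsum_cong_neutral) (use z c in auto)
  also have "\<dots> = T (ell2_delta \<one>) h * f k"
    using c by (simp add: m_assoc)
  finally show ?thesis .
qed

lemma group_vN_apply_outside:
  assumes H: "subgroup H G"
    and T: "T \<in> group_vN G H" and f: "f \<in> ell2 (carrier G)" "\<And>x. x \<notin> K \<Longrightarrow> f x = 0"
    and x: "x \<in> carrier G" "T f x \<noteq> 0"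
  obtains h k where "h \<in> H" "k \<in> K" "x = h \<otimes> k"
proof -
  have Tr: "T \<in> right_commutant"
    by (rule group_vN_right_commutant[OF subgroup.subset[OF H] T])
  have "\<exists>g\<in>carrier G. f g * T (ell2_delta \<one>) (x \<otimes> inv g) \<noteq> 0"
  proof (rule ccontr)
    assume "\<not> ?thesis"
    then have "T f x = 0"
      unfolding right_commutant_convolution[OF Tr f(1) x(1)] by (intro infsum_0) auto
    with x show False by simp
  qed
  then obtain g where g: "g \<in> carrier G" "f g * T (ell2_delta \<one>) (x \<otimes> inv g) \<noteq> 0" by blast
  then have "x \<otimes> inv g \<in> H" using group_vN_support[OF H T] by force
  moreover have "g \<in> K" using g f(2) by force
  moreover have "x = (x \<otimes> inv g) \<otimes> g" using g x by (simp add: m_assoc)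
  ultimately show thesis by (rule that)
qed

lemma canonical_trace_eq: "canonical_trace G T = T (ell2_delta \<one>) \<one>"
  by (simp add: canonical_trace_def ell2_inner_delta_right)

lemma trace_norm_eq:
  assumes T: "T \<in> bounded_ops (carrier G)"
  shows "trace_norm (carrier G) (canonical_trace G) T = ell2_norm (carrier G) (T (ell2_delta \<one>))"
proof -
  have d: "ell2_delta \<one> \<in> ell2 (carrier G)" by simp
  have "canonical_trace G (op_adjoint (carrier G) T \<circ> T)
      = ell2_inner (carrier G) (T (ell2_delta \<one>)) (T (ell2_delta \<one>))"
    unfolding canonical_trace_def comp_def
    by (rule op_adjoint_inner'[OF T bounded_ops_mem[OF T d] d])
  then show ?thesis by (simp add: trace_norm_def ell2_inner_self)
qed

end

section \<open>Subgroups in free position\<close>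

text \<open>
  The form in which freeness enters the computation: a product \<open>b a\<close> equals a product
  \<open>a' b'\<close> only in the obvious ways, that is, \<open>B A \<inter> A B = A \<union> B\<close> and \<open>A \<inter> B\<close> is trivial.
\<close>

locale free_pair = group +
  fixes A B
  assumes A: "subgroup A G" and B: "subgroup B G"
    and no_swap: "a \<in> A \<Longrightarrow> a' \<in> A \<Longrightarrow> b \<in> B \<Longrightarrow> b' \<in> B \<Longrightarrow> b \<otimes> a = a' \<otimes> b'
      \<Longrightarrow> b = \<one> \<and> b' = \<one> \<or> a = \<one> \<and> a' = \<one>"
begin

lemma A_Int_B: "A \<inter> B = {\<one>}"
proof -
  have "g = \<one>" if g: "g \<in> A" "g \<in> B" for g
    using no_swap[OF subgroup.one_closed[OF A] g(1) g(2) subgroup.one_closed[OF B]]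
      subgroup.mem_carrier[OF A g(1)] by auto
  then show ?thesis using subgroup.one_closed[OF A] subgroup.one_closed[OF B] by blast
qed

text \<open>
  With \<open>\<alpha>\<close>, \<open>\<beta>\<close> and \<open>\<eta>\<close> the values of \<open>x\<close>, \<open>z\<close> and \<open>v\<close> at \<open>\<delta>\<^sub>e\<close>, the vector \<open>v \<alpha>\<close> is supported in
  \<open>B A\<close> with value \<open>\<eta>(b) \<alpha>(a)\<close> at \<open>b a\<close>, and \<open>z \<eta>\<close> is supported in \<open>A B\<close> with value
  \<open>\<beta>(a) \<eta>(b)\<close> at \<open>a b\<close>.  Their product lives on \<open>A \<union> B\<close>.  The part on \<open>A\<close> sums to
  \<open>|\<eta>(e)|\<^sup>2 \<langle>\<alpha>, \<beta>\<rangle>\<close>; the part on \<open>B\<close> without \<open>e\<close> is \<open>\<alpha>(e)\<close> times the conjugate of \<open>\<beta>(e)\<close> times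
  \<open>\<parallel>\<eta>\<parallel>\<^sup>2 - |\<eta>(e)|\<^sup>2\<close>.
\<close>

lemma inner_swapped_products:
  assumes v: "v \<in> group_vN G B" and x: "x \<in> group_vN G A" and z: "z \<in> group_vN G A"
    and norm: "ell2_norm (carrier G) (v (ell2_delta \<one>)) = 1"
  defines "c \<equiv> (cmod (canonical_trace G v))\<^sup>2"
  shows "ell2_inner (carrier G) (v (x (ell2_delta \<one>))) (z (v (ell2_delta \<one>)))
    = c * ell2_inner (carrier G) (x (ell2_delta \<one>)) (z (ell2_delta \<one>))
      + (1 - c) * (canonical_trace G x * cnj (canonical_trace G z))"
proof -
  let ?S = "carrier G" and ?d = "ell2_delta \<one>"
  define al be et where "al = x ?d" and "be = z ?d" and "et = v ?d"
  note Ac = subgroup.subset[OF A] and Bc = subgroup.subset[OF B]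
  note A1 = subgroup.one_closed[OF A] and B1 = subgroup.one_closed[OF B]
  have mem: "al \<in> ell2 ?S" "be \<in> ell2 ?S" "et \<in> ell2 ?S"
    using assms unfolding al_def be_def et_def group_vN_def
    by (auto intro: bounded_ops_range commutant_bounded)
  have supp: "g \<notin> A \<Longrightarrow> al g = 0" "g \<notin> A \<Longrightarrow> be g = 0" "g \<notin> B \<Longrightarrow> et g = 0" for g
    unfolding al_def be_def et_def
    using group_vN_support[OF A x] group_vN_support[OF A z] group_vN_support[OF B v] by blast+
  have c: "complex_of_real c = et \<one> * cnj (et \<one>)"
    unfolding c_def canonical_trace_eq et_def by (rule complex_norm_square)
  \<comment> \<open>One formula for all \<open>g\<close>: the term with \<open>?d\<close> corrects for \<open>\<one>\<close> lying in both subgroups.\<close>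
  have eq: "v al g * cnj (z et g)
      = c * (al g * cnj (be g)) + al \<one> * cnj (be \<one>) * (et g * cnj (et g) + - c * (?d g * cnj (?d g)))"
    if g: "g \<in> ?S" for g
  proof -
    have BA: "B \<inter> A = {\<one>}" using A_Int_B by blast
    have inA: "v al g = et \<one> * al g \<and> z et g = be g * et \<one>" if "g \<in> A"
      using group_vN_apply_product[OF B A BA v mem(1) supp(1) B1 that]
        group_vN_apply_product[OF A B A_Int_B z mem(3) supp(3) that B1] g
      by (simp add: et_def be_def)
    have inB: "v al g = et g * al \<one> \<and> z et g = be \<one> * et g" if "g \<in> B"
      using group_vN_apply_product[OF B A BA v mem(1) supp(1) that A1]
        group_vN_apply_product[OF A B A_Int_B z mem(3) supp(3) A1 that] g
      by (simp add: et_def be_def)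
    consider "g = \<one>" | "g \<in> A" "g \<notin> B" "g \<noteq> \<one>" | "g \<in> B" "g \<notin> A" "g \<noteq> \<one>" | "g \<notin> A" "g \<notin> B"
      using A_Int_B A1 by blast
    then show ?thesis
    proof cases
      case 1
      then show ?thesis using inA A1 by (simp add: c ell2_delta_def)
    next
      case 2
      then show ?thesis using inA supp by (simp add: c ell2_delta_def)
    next
      case 3
      then show ?thesis using inB supp by (simp add: ell2_delta_def)
    next
      case 4
      have "v al g = 0 \<or> z et g = 0"
      proof (rule ccontr)
        assume nz: "\<not> ?thesis"
        obtain b a where ba: "b \<in> B" "a \<in> A" "g = b \<otimes> a"
          using group_vN_apply_outside[OF B v mem(1) supp(1) g] nz by blast
        obtain a' b' where ab: "a' \<in> A" "b' \<in> B" "g = a' \<otimes> b'"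
          using group_vN_apply_outside[OF A z mem(3) supp(3) g] nz by blast
        have "b = \<one> \<and> b' = \<one> \<or> a = \<one> \<and> a' = \<one>"
          using no_swap[of a a' b b'] ba ab by simp
        then have "g \<in> A \<or> g \<in> B" using ba Ac Bc by auto
        with 4 show False by blast
      qed
      with 4 A1 show ?thesis using supp by (auto simp: ell2_delta_def)
    qed
  qed
  have "((\<lambda>g. c * (al g * cnj (be g)) + al \<one> * cnj (be \<one>) * (et g * cnj (et g) + - c * (?d g * cnj (?d g))))
      has_sum (c * ell2_inner ?S al be
        + al \<one> * cnj (be \<one>) * (ell2_inner ?S et et + - c * ell2_inner ?S ?d ?d))) ?S"
    unfolding ell2_inner_def
    by (intro has_sum_add has_sum_cmult_right has_sum_infsum ell2_inner_summable)
      (use mem in auto)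
  then have "((\<lambda>g. v al g * cnj (z et g))
      has_sum (c * ell2_inner ?S al be
        + al \<one> * cnj (be \<one>) * (ell2_inner ?S et et + - c * ell2_inner ?S ?d ?d))) ?S"
    by (rule has_sum_cong[THEN iffD2, rotated]) (rule eq)
  then have "ell2_inner ?S (v al) (z et)
      = c * ell2_inner ?S al be + al \<one> * cnj (be \<one>) * (ell2_inner ?S et et + - c * ell2_inner ?S ?d ?d)"
    unfolding ell2_inner_def by (rule infsumI)
  also have "ell2_inner ?S et et = 1" using norm by (simp add: ell2_inner_self et_def)
  also have "ell2_inner ?S ?d ?d = 1" by (simp add: ell2_inner_self)
  finally show ?thesis
    by (simp add: al_def be_def et_def canonical_trace_eq algebra_simps)
qed

text \<open>
  The distance is \<open>\<parallel>x\<delta>\<^sub>e - u z u\<^sup>*\<delta>\<^sub>e\<parallel>\<close>.  Moving \<open>u\<close> to the other side of the mixed inner product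
  produces the situation of the previous lemma with \<open>v = u\<^sup>*\<close>, and \<open>u z u\<^sup>*\<close> has the same trace norm
  as \<open>z\<close>.  The result is symmetric in \<open>x\<close> and \<open>z\<close>.
\<close>

lemma distance_to_conjugate:
  assumes uB: "u \<in> group_vN G B" and u: "unitary_op (carrier G) u"
    and x: "x \<in> group_vN G A" and z: "z \<in> group_vN G A"
  defines "c \<equiv> (cmod (canonical_trace G u))\<^sup>2"
  shows "(trace_norm (carrier G) (canonical_trace G)
      (op_diff x (u \<circ> z \<circ> op_adjoint (carrier G) u)))\<^sup>2
    = (ell2_norm (carrier G) (x (ell2_delta \<one>)))\<^sup>2 + (ell2_norm (carrier G) (z (ell2_delta \<one>)))\<^sup>2
      - 2 * (c * Re (ell2_inner (carrier G) (x (ell2_delta \<one>)) (z (ell2_delta \<one>)))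
             + (1 - c) * Re (canonical_trace G x * cnj (canonical_trace G z)))"
proof -
  let ?S = "carrier G" and ?d = "ell2_delta \<one>"
  define v where "v = op_adjoint ?S u"
  have d: "?d \<in> ell2 ?S" by simp
  note uR = group_vN_right_commutant[OF subgroup.subset[OF B] uB]
  note xR = group_vN_right_commutant[OF subgroup.subset[OF A] x]
  note zR = group_vN_right_commutant[OF subgroup.subset[OF A] z]
  note ub = commutant_bounded[OF uR] and xb = commutant_bounded[OF xR]
    and zb = commutant_bounded[OF zR]
  have vb: "v \<in> bounded_ops ?S" unfolding v_def by (rule op_adjoint_bounded[OF ub])
  have vB: "v \<in> group_vN G B" unfolding v_def by (rule group_vN_adjoint[OF B uB])
  note vR = group_vN_right_commutant[OF subgroup.subset[OF B] vB]
  have v1: "ell2_norm ?S (v ?d) = 1"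
    using unitary_op_norm(2)[OF u d] by (simp add: v_def)
  have trv: "cmod (canonical_trace G v) = cmod (canonical_trace G u)"
    using right_commutant_adjoint_delta_one[OF uR one_closed] by (simp add: canonical_trace_eq v_def)
  have "ell2_inner ?S (x ?d) (u (z (v ?d))) = ell2_inner ?S (v (x ?d)) (z (v ?d))"
    unfolding v_def using op_adjoint_inner'[OF ub bounded_ops_range[OF xb] bounded_ops_range[OF zb]]
    by simp
  also have "\<dots> = c * ell2_inner ?S (x ?d) (z ?d)
      + (1 - c) * (canonical_trace G x * cnj (canonical_trace G z))"
    using inner_swapped_products[OF vB x z v1] by (simp add: trv c_def)
  finally have inner: "Re (ell2_inner ?S (x ?d) (u (z (v ?d)))) = c * Re (ell2_inner ?S (x ?d) (z ?d))
      + (1 - c) * Re (canonical_trace G x * cnj (canonical_trace G z))"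
    by simp
  \<comment> \<open>\<open>u\<close> on the left is an isometry; to remove \<open>u\<^sup>*\<close> on the right, pass to adjoints.\<close>
  have "ell2_norm ?S (u (z (v ?d))) = ell2_norm ?S ((z \<circ> v) ?d)"
    using unitary_op_norm(1)[OF u bounded_ops_range[OF zb]] by simp
  also have "\<dots> = ell2_norm ?S (op_adjoint ?S (z \<circ> v) ?d)"
    by (rule right_commutant_adjoint_norm[OF commutant_comp[OF zR vR], symmetric])
  also have "\<dots> = ell2_norm ?S (u (op_adjoint ?S z ?d))"
    using op_adjoint_comp[OF zb vb] op_adjoint_adjoint[OF ub] by (simp add: v_def)
  also have "\<dots> = ell2_norm ?S (op_adjoint ?S z ?d)"
    by (rule unitary_op_norm(1)[OF u bounded_ops_range[OF op_adjoint_bounded[OF zb]]])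
  also have "\<dots> = ell2_norm ?S (z ?d)"
    by (rule right_commutant_adjoint_norm[OF zR])
  finally have norm: "ell2_norm ?S (u (z (v ?d))) = ell2_norm ?S (z ?d)" .
  have "op_diff x (u \<circ> z \<circ> v) \<in> bounded_ops ?S"
    by (intro op_diff_bounded bounded_ops_comp xb ub zb vb)
  then have "trace_norm ?S (canonical_trace G) (op_diff x (u \<circ> z \<circ> v))
      = ell2_norm ?S (\<lambda>i. x ?d i - u (z (v ?d)) i)"
    by (simp add: trace_norm_eq op_diff_def)
  then show ?thesis
    unfolding v_def[symmetric]
    using ell2_norm_diff_square[OF bounded_ops_range[OF xb] bounded_ops_range[OF ub], of ?d "z (v ?d)"]
      norm inner by simp
qed

end

text \<open>
  The shape of each half of the Mashood--Taylor distance: every point has a neighbour within \<open>s\<close>,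
  and some point has none closer.
\<close>

lemma minimax_eqI:
  fixes gap :: "'a \<Rightarrow> 'b \<Rightarrow> real"
  assumes nonneg: "\<And>x z. x \<in> X \<Longrightarrow> z \<in> Y \<Longrightarrow> 0 \<le> gap x z" and Y: "Y \<noteq> {}"
    and near: "\<And>x. x \<in> X \<Longrightarrow> \<exists>z\<in>Y. gap x z \<le> s"
    and x0: "x0 \<in> X" "\<And>z. z \<in> Y \<Longrightarrow> s \<le> gap x0 z"
  shows "(SUP x\<in>X. INF z\<in>Y. gap x z) = s"
proof -
  have bdd: "bdd_below (gap x ` Y)" if "x \<in> X" for x
    using nonneg[OF that] by (rule bdd_belowI2)
  have le: "(INF z\<in>Y. gap x z) \<le> s" if x: "x \<in> X" for x
    using near[OF x] cINF_lower2[OF bdd[OF x]] by blast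
  have "s \<le> (INF z\<in>Y. gap x0 z)" using Y x0(2) by (rule cINF_greatest)
  also have "\<dots> \<le> (SUP x\<in>X. INF z\<in>Y. gap x z)"
    by (rule cSUP_upper[OF x0(1) bdd_aboveI2[OF le]])
  finally have "s \<le> (SUP x\<in>X. INF z\<in>Y. gap x z)" .
  moreover have "(SUP x\<in>X. INF z\<in>Y. gap x z) \<le> s"
    by (rule cSUP_least[OF _ le]) (use x0 in blast)
  ultimately show ?thesis by simp
qed

context free_pair
begin

text \<open>
  Completing the square in the distance formula shows that the best \<open>z\<close> is
  \<open>c x + (1 - c) \<tau>(x) 1\<close>, the conditional expectation of \<open>u\<^sup>* x u\<close>.  Being a convex combination of
  \<open>x\<close> and the scalar \<open>\<tau>(x)\<close>, it stays in the unit ball, and it leaves the square distance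
  \<open>(1 - c\<^sup>2) (\<parallel>x\<parallel>\<^sup>2 - |\<tau>(x)|\<^sup>2)\<close>.
\<close>

lemma conjugate_near:
  assumes uB: "u \<in> group_vN G B" and u: "unitary_op (carrier G) u"
    and x: "x \<in> op_unit_ball (carrier G) (group_vN G A)"
  defines "c \<equiv> (cmod (canonical_trace G u))\<^sup>2"
  obtains z where "z \<in> op_unit_ball (carrier G) (group_vN G A)"
    and "(trace_norm (carrier G) (canonical_trace G)
      (op_diff x (u \<circ> z \<circ> op_adjoint (carrier G) u)))\<^sup>2 \<le> 1 - c\<^sup>2"
proof -
  let ?S = "carrier G" and ?d = "ell2_delta \<one>"
  have d: "?d \<in> ell2 ?S" "ell2_norm ?S ?d = 1" by simp_all
  have xA: "x \<in> group_vN G A" and "op_norm ?S x \<le> 1" using x by (auto simp: op_unit_ball_def)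
  have xb: "x \<in> bounded_ops ?S" using xA unfolding group_vN_def by (rule commutant_bounded)
  note ub = unitary_op_bounded[OF u]
  have ball: "ell2_norm ?S (x f) \<le> 1" if "f \<in> ell2 ?S" "ell2_norm ?S f \<le> 1" for f
    using \<open>op_norm ?S x \<le> 1\<close> that by (simp add: op_norm_le_1_iff[OF xb])
  define al where "al = x ?d"
  define t where "t = canonical_trace G x"
  have al: "al \<in> ell2 ?S" unfolding al_def by (rule bounded_ops_range[OF xb])
  have al1: "ell2_norm ?S al \<le> 1" unfolding al_def by (rule ball) simp_all
  have ald: "ell2_inner ?S al ?d = t" "ell2_inner ?S ?d al = cnj t"
    by (simp_all add: ell2_inner_delta_right ell2_inner_delta_left t_def canonical_trace_eq al_def)
  have t1: "cmod t \<le> 1"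
    using ell2_cauchy_schwarz[OF al d(1)] al1 by (simp add: ald)
  have c: "0 \<le> c" "c \<le> 1"
  proof -
    have "cmod (canonical_trace G u) \<le> ell2_norm ?S (u ?d) * ell2_norm ?S ?d"
      unfolding canonical_trace_def by (rule ell2_cauchy_schwarz[OF bounded_ops_range[OF ub] d(1)])
    also have "\<dots> = 1" using unitary_op_norm(1)[OF u d(1)] by simp
    finally show "c \<le> 1" by (simp add: c_def power_le_one)
  qed (simp add: c_def)
  define k where "k = complex_of_real (1 - c) * t"
  define z where "z = (\<lambda>f i. complex_of_real c * x f i + k * op_id ?S f i)"
  have zA: "z \<in> group_vN G A"
    unfolding z_def by (rule group_vN_lincomb[OF xA op_id_group_vN])
  have zb: "z \<in> bounded_ops ?S" using zA unfolding group_vN_def by (rule commutant_bounded)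
  have "ell2_norm ?S (z f) \<le> 1" if f: "f \<in> ell2 ?S" "ell2_norm ?S f \<le> 1" for f
  proof -
    have "z f = (\<lambda>i. complex_of_real c * x f i + k * f i)"
      using f by (simp add: z_def op_id_def)
    then have "ell2_norm ?S (z f) \<le> cmod (complex_of_real c) * ell2_norm ?S (x f) + cmod k * ell2_norm ?S f"
      using ell2_norm_triangle[OF ell2_scale[OF bounded_ops_range[OF xb]] ell2_scale[OF f(1)]]
      by (simp add: ell2_norm_scale del: norm_of_real)
    also have "\<dots> \<le> cmod (complex_of_real c) * 1 + cmod k * 1"
      using ball[OF f] f(2) by (intro add_mono mult_left_mono) auto
    also have "\<dots> \<le> c + (1 - c) * 1"
      unfolding k_def norm_mult norm_of_real mult_1_right
      using c t1 mult_left_mono[of "cmod t" 1 "1 - c"] by simp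
    finally show ?thesis by simp
  qed
  then have "z \<in> op_unit_ball ?S (group_vN G A)"
    using zA zb by (simp add: op_unit_ball_def op_norm_le_1_iff)
  moreover have "(trace_norm ?S (canonical_trace G) (op_diff x (u \<circ> z \<circ> op_adjoint ?S u)))\<^sup>2 \<le> 1 - c\<^sup>2"
  proof -
    define n where "n = (ell2_norm ?S al)\<^sup>2"
    have n: "n \<le> 1" using al1 by (simp add: n_def power_le_one)
    have nal: "ell2_inner ?S al al = of_real n" by (simp add: n_def ell2_inner_self)
    have zd: "z ?d = (\<lambda>i. complex_of_real c * al i + k * ?d i)"
      by (simp add: z_def al_def op_id_def)
    have tz: "canonical_trace G z = t"
      unfolding canonical_trace_eq zd ell2_delta_def[of \<one>, THEN fun_cong]
      by (simp add: k_def al_def t_def canonical_trace_eq algebra_simps)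
    have ip: "ell2_inner ?S f (z ?d) = c * ell2_inner ?S f al + cnj k * ell2_inner ?S f ?d"
      if "f \<in> ell2 ?S" for f
      unfolding zd by (simp add: ell2_inner_add_right[OF ell2_scale[OF al] ell2_scale[OF d(1)] that]
          ell2_inner_scale_right)
    have m: "(\<lambda>i. complex_of_real c * al i + k * ?d i) \<in> ell2 ?S"
      using al by simp
    have i1: "ell2_inner ?S al (z ?d) = c * n + cnj k * t"
      by (simp add: ip[OF al] nal ald)
    have i2: "ell2_inner ?S ?d (z ?d) = c * cnj t + cnj k"
      by (simp add: ip ald ell2_inner_self)
    have i3: "ell2_inner ?S (z ?d) (z ?d) = c * (c * n + cnj k * t) + k * (c * cnj t + cnj k)"
    proof -
      have "ell2_inner ?S (z ?d) (z ?d)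
          = c * ell2_inner ?S al (z ?d) + k * ell2_inner ?S ?d (z ?d)"
        unfolding zd by (simp add: ell2_inner_add_left[OF ell2_scale[OF al] ell2_scale[OF d(1)] m]
            ell2_inner_scale_left)
      then show ?thesis by (simp only: i1 i2)
    qed
    define q where "q = (cmod t)\<^sup>2"
    have q: "t * cnj t = of_real q" "cnj t * t = of_real q"
      by (simp_all add: q_def complex_norm_square mult.commute del: of_real_power)
    have kt: "cnj k * t = of_real ((1 - c) * q)" "k * cnj t = of_real ((1 - c) * q)"
      "k * cnj k = of_real ((1 - c)\<^sup>2 * q)"
    proof -
      show kt1: "cnj k * t = of_real ((1 - c) * q)"
        unfolding k_def complex_cnj_mult complex_cnj_complex_of_real mult.assoc q by simp
      show "k * cnj t = of_real ((1 - c) * q)"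
        unfolding k_def mult.assoc q by simp
      have "k * cnj k = complex_of_real (1 - c) * (cnj k * t)" by (simp add: k_def)
      then show "k * cnj k = of_real ((1 - c)\<^sup>2 * q)"
        by (simp add: kt1 power2_eq_square)
    qed
    have r1: "Re (ell2_inner ?S al (z ?d)) = c * n + (1 - c) * q"
      unfolding i1 kt by simp
    have "ell2_inner ?S (z ?d) (z ?d)
        = of_real (c * (c * n + (1 - c) * q) + (c * ((1 - c) * q) + (1 - c)\<^sup>2 * q))"
      unfolding i3 kt distrib_left mult.left_commute[of k "complex_of_real c"] by simp
    then have r2: "(ell2_norm ?S (z ?d))\<^sup>2
        = c * (c * n + (1 - c) * q) + (c * ((1 - c) * q) + (1 - c)\<^sup>2 * q)"
      by (simp only: ell2_norm_eq_Re Re_complex_of_real)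
    have "(trace_norm ?S (canonical_trace G) (op_diff x (u \<circ> z \<circ> op_adjoint ?S u)))\<^sup>2
        = (1 - c\<^sup>2) * (n - q)"
      unfolding distance_to_conjugate[OF uB u xA zA] c_def[symmetric] tz
      unfolding t_def[symmetric] al_def[symmetric] n_def[symmetric] r1 r2 q Re_complex_of_real
      by (simp add: algebra_simps power2_eq_square)
    also have "\<dots> \<le> (1 - c\<^sup>2) * 1"
      using c n by (intro mult_left_mono) (auto simp: q_def power_le_one intro: order_trans[of _ n])
    finally show ?thesis by simp
  qed
  ultimately show thesis by (rule that)
qed

text \<open>
  A translation by \<open>a \<noteq> e\<close> has trace zero and trace norm one.  With \<open>w\<close> the coefficient of \<open>z\<close> at \<open>a\<close>,
  the square distance is at least \<open>1 + |w|\<^sup>2 - 2 c |w| = 1 - c\<^sup>2 + (|w| - c)\<^sup>2\<close>.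
\<close>

lemma conjugate_far:
  assumes uB: "u \<in> group_vN G B" and u: "unitary_op (carrier G) u"
    and a: "a \<in> A" "a \<noteq> \<one>" and z: "z \<in> group_vN G A"
  defines "c \<equiv> (cmod (canonical_trace G u))\<^sup>2"
  shows "1 - c\<^sup>2 \<le> (trace_norm (carrier G) (canonical_trace G)
      (op_diff (left_translation G a) (u \<circ> z \<circ> op_adjoint (carrier G) u)))\<^sup>2"
proof -
  let ?S = "carrier G" and ?d = "ell2_delta \<one>"
  have ac: "a \<in> ?S" using a subgroup.mem_carrier[OF A] by blast
  have zb: "z \<in> bounded_ops ?S" using z unfolding group_vN_def by (rule commutant_bounded)
  define w where "w = z ?d a"
  have la: "left_translation G a ?d = ell2_delta a" by (rule left_translation_delta_one[OF ac])
  have w: "cmod w \<le> ell2_norm ?S (z ?d)"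
    using ell2_cauchy_schwarz[OF bounded_ops_range[OF zb, of ?d] ell2_delta_mem[OF ac]] ac
    by (simp add: ell2_inner_delta_right w_def)
  have "1 - c\<^sup>2 \<le> 1 + (cmod w)\<^sup>2 - 2 * (c * cmod w)"
    using zero_le_power2[of "cmod w - c"] by (simp add: power2_diff mult.commute)
  also have "\<dots> \<le> 1 + (ell2_norm ?S (z ?d))\<^sup>2 - 2 * (c * Re w)"
  proof -
    have "(cmod w)\<^sup>2 \<le> (ell2_norm ?S (z ?d))\<^sup>2" using w by (rule power_mono) simp
    moreover have "c * Re w \<le> c * cmod w"
      using complex_Re_le_cmod[of w] by (rule mult_left_mono) (simp add: c_def)
    ultimately show ?thesis by linarith
  qed
  also have "\<dots> = (trace_norm ?S (canonical_trace G)
      (op_diff (left_translation G a) (u \<circ> z \<circ> op_adjoint ?S u)))\<^sup>2"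
    unfolding distance_to_conjugate[OF uB u left_translation_group_vN[OF subgroup.subset[OF A] a(1)] z]
      c_def[symmetric] canonical_trace_eq[of "left_translation G a"] la
    using a ac by (simp add: ell2_inner_delta_left w_def ell2_delta_def[of a, THEN fun_cong])
  finally show ?thesis .
qed

theorem mt_dist_conjugate:
  assumes uB: "u \<in> group_vN G B" and u: "unitary_op (carrier G) u" and A_nontrivial: "A \<noteq> {\<one>}"
  shows "mt_dist (carrier G) (canonical_trace G) (group_vN G A)
      (op_conjugate (carrier G) u (group_vN G A))
    = sqrt (1 - cmod (canonical_trace G u) ^ 4)"
proof -
  let ?S = "carrier G"
  let ?X = "op_unit_ball ?S (group_vN G A)"
  define gap where "gap = (\<lambda>x z. trace_norm ?S (canonical_trace G)
    (op_diff x (u \<circ> z \<circ> op_adjoint ?S u)))"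
  define c where "c = (cmod (canonical_trace G u))\<^sup>2"
  define s where "s = sqrt (1 - c\<^sup>2)"
  obtain a where a: "a \<in> A" "a \<noteq> \<one>" using A_nontrivial subgroup.one_closed[OF A] by blast
  have ac: "a \<in> ?S" using a subgroup.mem_carrier[OF A] by blast
  have nonneg: "0 \<le> gap x z" if "x \<in> group_vN G A" "z \<in> group_vN G A" for x z
  proof -
    have "op_diff x (u \<circ> z \<circ> op_adjoint ?S u) \<in> bounded_ops ?S"
      using that unitary_op_bounded[OF u] unfolding group_vN_def
      by (intro op_diff_bounded bounded_ops_comp op_adjoint_bounded) (auto dest: commutant_bounded)
    then show ?thesis by (simp add: gap_def trace_norm_eq)
  qed
  have X: "?X \<subseteq> group_vN G A" by (auto simp: op_unit_ball_def)
  have nonneg_ball: "0 \<le> gap x z" if "x \<in> ?X" "z \<in> ?X" for x z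
    by (rule nonneg) (use that X in blast)+
  have sym: "gap x z = gap z x" if "x \<in> group_vN G A" "z \<in> group_vN G A" for x z
  proof -
    have "Re (ell2_inner ?S f g) = Re (ell2_inner ?S g f)" for f g
      by (subst ell2_inner_commute) simp
    then have "(gap x z)\<^sup>2 = (gap z x)\<^sup>2"
      unfolding gap_def distance_to_conjugate[OF uB u that] distance_to_conjugate[OF uB u that(2,1)]
      by (simp add: mult.commute)
    then show ?thesis using nonneg that by (simp add: power2_eq_iff_nonneg)
  qed
  have near: "\<exists>z\<in>?X. gap x z \<le> s" if x: "x \<in> ?X" for x
  proof -
    obtain z where z: "z \<in> ?X" "(gap x z)\<^sup>2 \<le> 1 - c\<^sup>2"
      using conjugate_near[OF uB u x] unfolding gap_def c_def by metis
    from z(2) have "gap x z \<le> s" unfolding s_def by (rule real_le_rsqrt)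
    with z(1) show ?thesis by blast
  qed
  define l where "l = left_translation G a"
  have lA: "l \<in> group_vN G A"
    unfolding l_def by (rule left_translation_group_vN[OF subgroup.subset[OF A] a(1)])
  have l: "l \<in> ?X"
  proof -
    have "ell2_norm ?S (l f) = ell2_norm ?S f" if "f \<in> ell2 ?S" for f
      unfolding l_def left_translation_perm
      by (rule perm_op_norm(2)[OF bij_left_mult that]) (simp add: ac)
    then show ?thesis
      using lA left_translation_bounded[OF ac, folded l_def]
      by (simp add: op_unit_ball_def op_norm_le_1_iff)
  qed
  have far: "s \<le> gap l z" if z: "z \<in> ?X" for z
  proof -
    have zA: "z \<in> group_vN G A" using z X by blast
    have "1 - c\<^sup>2 \<le> (gap l z)\<^sup>2"
      unfolding c_def gap_def l_def by (rule conjugate_far[OF uB u a zA])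
    then show ?thesis unfolding s_def by (rule real_le_lsqrt[OF nonneg[OF lA zA]])
  qed
  have ball: "op_unit_ball ?S (op_conjugate ?S u (group_vN G A))
      = (\<lambda>T. u \<circ> T \<circ> op_adjoint ?S u) ` ?X"
    by (rule op_unit_ball_conjugate[OF u]) (auto simp: group_vN_def commutant_bounded)
  have 1: "(SUP x\<in>?X. INF z\<in>?X. gap x z) = s"
    by (rule minimax_eqI[where ?x0.0 = l]) (use nonneg_ball near far l in auto)
  have 2: "(SUP z\<in>?X. INF x\<in>?X. gap x z) = s"
  proof (rule minimax_eqI[where ?x0.0 = l])
    fix z assume z: "z \<in> ?X"
    show "\<exists>x\<in>?X. gap x z \<le> s" using near[OF z] sym z X by (metis subsetD)
    show "s \<le> gap z l" using far[OF z] sym[of z l] z X lA by auto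
  qed (use nonneg_ball l in auto)
  have "mt_dist ?S (canonical_trace G) (group_vN G A) (op_conjugate ?S u (group_vN G A)) = max s s"
    unfolding mt_dist_def ball image_image using 1 2 by (simp add: gap_def)
  then show ?thesis by (simp add: s_def c_def flip: power_mult)
qed

end

section \<open>The free group\<close>

lemma foldr_cons_letter_append:
  "reduced_word (v @ w) \<Longrightarrow> foldr cons_letter v w = v @ w"
proof (induction v)
  case (Cons l v)
  then show ?case
    using reduced_word_ConsD[of l "v @ w"] cons_letter_reduced[of l "v @ w"] by simp
qed simp

lemma generate_free_gen_letters:
  assumes x: "x \<in> X" and w: "w \<in> generate (free_group X) {free_gen x}"
  shows "reduced_word w \<and> fst ` set w \<subseteq> {x}"
  using w
proof induction
  case (inv h)
  interpret group "free_group X" by (rule group_free_group)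
  have "inv\<^bsub>free_group X\<^esub> free_gen x = [(x, False)]"
    by (rule inv_equality)
      (use x in \<open>auto simp: free_group_def free_gen_def inv_letter_def reduced_word_def\<close>)
  with inv show ?case by (simp add: reduced_word_def)
next
  case (eng v w)
  then show ?case
    using set_foldr_cons_letter[of v w] by (fastforce simp: free_group_def reduced_foldr_cons_letter)
qed (auto simp: free_group_def free_gen_def reduced_word_def)

lemma foldr_cons_letter_disjoint:
  assumes "reduced_word v" "reduced_word w" "fst ` set v \<inter> fst ` set w = {}"
  shows "foldr cons_letter v w = v @ w"
proof (rule foldr_cons_letter_append)
  have "hd w \<noteq> inv_letter (last v)" if "v \<noteq> []" "w \<noteq> []"
    using assms(3) that by (metis disjoint_iff fst_inv_letter hd_in_set image_eqI last_in_set)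
  with assms show "reduced_word (v @ w)"
    unfolding reduced_word_def successively_append_iff by blast
qed

text \<open>
  For reduced words without a common generator the product is the concatenation.  An equation
  \<open>b a = a' b'\<close> thus becomes one between words, and comparing first letters decides which of the two
  sides degenerate.
\<close>

lemma free_pair_free_group:
  assumes x: "x \<in> X" and y: "y \<in> X" and xy: "x \<noteq> y"
  shows "free_pair (free_group X) (generate (free_group X) {free_gen x})
    (generate (free_group X) {free_gen y})"
proof -
  interpret group "free_group X" by (rule group_free_group)
  note letters = generate_free_gen_letters[OF x] generate_free_gen_letters[OF y]
  have gen: "subgroup (generate (free_group X) {free_gen z}) (free_group X)" if "z \<in> X" for z
    by (rule generate_is_subgroup) (use that in \<open>auto simp: free_group_def free_gen_def reduced_word_def\<close>)
  have concat: "foldr cons_letter v w = v @ w"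
    if "reduced_word v \<and> fst ` set v \<subseteq> {p}" "reduced_word w \<and> fst ` set w \<subseteq> {q}" "p \<noteq> q"
    for v w :: "'a letter list" and p q
    by (rule foldr_cons_letter_disjoint) (use that in auto)
  show ?thesis
  proof (rule free_pair.intro[OF group_axioms free_pair_axioms.intro[OF gen[OF x] gen[OF y]]])
    fix a a' b b'
    assume a: "a \<in> generate (free_group X) {free_gen x}" "a' \<in> generate (free_group X) {free_gen x}"
      and b: "b \<in> generate (free_group X) {free_gen y}" "b' \<in> generate (free_group X) {free_gen y}"
      and eq: "b \<otimes>\<^bsub>free_group X\<^esub> a = a' \<otimes>\<^bsub>free_group X\<^esub> b'"
    note la = a[THEN letters(1)] and lb = b[THEN letters(2)]
    have words: "b @ a = a' @ b'"
      using eq concat[OF lb(1) la(1) xy[symmetric]] concat[OF la(2) lb(2) xy]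
      by (simp add: free_group_def)
    have "b = [] \<and> b' = [] \<or> a = [] \<and> a' = []"
    proof (cases "b = []")
      case True
      then have "set b' \<subseteq> set a" using words by auto
      then have "b' = []" using la lb xy by (cases b') force+
      with True show ?thesis by simp
    next
      case False
      have "a' = []"
      proof (rule ccontr)
        assume "a' \<noteq> []"
        then have "hd b = hd a'" using words False by (metis hd_append2)
        then show False
          using la lb xy False \<open>a' \<noteq> []\<close> by (cases b; cases a') auto
      qed
      moreover from this have "set a \<subseteq> set b'" using words by auto
      then have "a = []" using la lb xy by (cases a) force+
      ultimately show ?thesis by simp
    qed
    then show "b = \<one>\<^bsub>free_group X\<^esub> \<and> b' = \<one>\<^bsub>free_group X\<^esub>
        \<or> a = \<one>\<^bsub>free_group X\<^esub> \<and> a' = \<one>\<^bsub>free_group X\<^esub>"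
      by (simp add: free_group_def)
  qed
qed

theorem theoremG:
  fixes u :: "generator letter list ell2_op"
  assumes "u \<in> group_vN F2 (generate F2 {gen_b})"
    and "unitary_op (carrier F2) u"
  shows "mt_dist (carrier F2) (canonical_trace F2)
           (group_vN F2 (generate F2 {gen_a}))
           (op_conjugate (carrier F2) u (group_vN F2 (generate F2 {gen_a})))
         = sqrt (1 - cmod (canonical_trace F2 u) ^ 4)"
proof (rule free_pair.mt_dist_conjugate)
  show "free_pair F2 (generate F2 {gen_a}) (generate F2 {gen_b})"
    by (rule free_pair_free_group) auto
  have "gen_a \<in> generate F2 {gen_a}" by (rule generate.incl) simp
  then show "generate F2 {gen_a} \<noteq> {\<one>\<^bsub>F2\<^esub>}"
    by (auto simp: free_group_def free_gen_def)
qed (use assms in auto)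

end
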